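(* Let $\mathcal{X}=\{\mathcal{X}_n\}$ be a spike prior and $\mathcal{P}$ a probability distribution on $\mathbb{R}$ with mean $0$ and variance $1$. Assume the following of $x\sim\mathcal{X}_n$: (i) with probability $1-o(1)$ as $n\to\infty$, $|x_i|<n^{-1/3}$ for all $i\in\{1,\dots,n\}$; (ii) for each $q\in\{2,4,6,8\}$ there exists a constant $\alpha_q$ with $\Pr\left[\|x\|_q>\alpha_q n^{\frac1q-\frac12}\right]=o(1)$. Assume the following of $\mathcal{P}$: (iii) $\mathcal{P}$ is a continuous distribution with a (differentiable) density function $p(w)$; (iv) $p(w)>0$ for all $w\in\mathbb{R}$; (v) the translation function $\tau$ of $\mathcal{P}$ is (finite and) $C^4$ in a neighborhood of $(0,0)$; (vi) $\mathcal{P}$ is symmetric about $0$. Then for every $\lambda\ge0$ with $\lambda<\lambda^*_{\mathcal{X}}/\sqrt{F_{\mathcal{P}}}$, $\mathrm{Wig}_n(\lambda,\mathcal{P},\mathcal{X})$ is contiguous to $\mathrm{Wig}_n(0,\mathcal{P})$.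
   Context: A spike prior is a family $\mathcal{X}=\{\mathcal{X}_n\}$ with $\mathcal{X}_n$ a probability distribution on $\mathbb{R}^n$ such that $x^{(n)}\sim\mathcal{X}_n$ satisfies $\|x^{(n)}\|\to1$ in probability. $\mathrm{Wig}_n(\lambda,\mathcal{P},\mathcal{X})$ is the law of the $n\times n$ symmetric matrix $Y$ whose off-diagonal entries are those of $\lambda xx^\top+\frac1{\sqrt n}W$ and whose diagonal entries are set to $0$, where $x\sim\mathcal{X}_n$ and, independently of $x$, $W$ is a symmetric matrix whose off-diagonal entries are drawn from $\mathcal{P}$, independently except for $W_{ij}=W_{ji}$. $\mathrm{Wig}_n(0,\mathcal{P})$ is the case $\lambda=0$. The translation function of $\mathcal{P}$ is $$\tau(a,b)=\log\mathbb{E}_{z\sim\mathcal{P}}\left[\frac{p(z-a)}{p(z)}\,\frac{p(z-b)}{p(z)}\right].$$ The Fisher information of $\mathcal{P}$ is $F_{\mathcal{P}}=\int_{-\infty}^\infty\frac{p'(w)^2}{p(w)}\,dw$. The Gaussian second-moment threshold of $\mathcal{X}$ is $$\lambda^*_{\mathcal{X}}=\sup\left\{\lambda\ge0:\ \mathbb{E}_{x,x'\sim\mathcal{X}_n}\exp\left(\tfrac{\lambda^2n}{2}\langle x,x'\rangle^2\right)\text{ is bounded as }n\to\infty\right\},$$ with $x,x'$ independent. Contiguity: for sequences of probability measures $P_n,Q_n$ on measurable spaces $(\Omega_n,\mathcal{F}_n)$, $P_n$ is contiguous to $Q_n$ if for every sequence of events $A_n\in\mathcal{F}_n$, $Q_n(A_n)\to0$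 implies $P_n(A_n)\to0$ as $n\to\infty$. *)

theory Defs
  imports "HOL-Probability.Probability"
begin

text \<open>
  A vector in \<open>\<real>\<^sup>n\<close> is an element of \<^term>\<open>space (vec_space n)\<close>, i.e. a function on the naturals
  whose coordinates are the values at \<open>0, \<dots>, n - 1\<close> (and \<^term>\<open>undefined\<close> elsewhere).  Matrices are
  treated likewise.
\<close>

abbreviation vec_space :: "nat \<Rightarrow> (nat \<Rightarrow> real) measure" where
  "vec_space n \<equiv> PiM {..<n} (\<lambda>_. borel)"

abbreviation mat_space :: "nat \<Rightarrow> (nat \<times> nat \<Rightarrow> real) measure" where
  "mat_space n \<equiv> PiM ({..<n} \<times> {..<n}) (\<lambda>_. borel)"

definition lq_norm :: "nat \<Rightarrow> nat \<Rightarrow> (nat \<Rightarrow> real) \<Rightarrow> real" where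
  "lq_norm q n x = root q (\<Sum>i<n. \<bar>x i\<bar> ^ q)"

definition spike_prior :: "(nat \<Rightarrow> (nat \<Rightarrow> real) measure) \<Rightarrow> bool" where
  "spike_prior X \<longleftrightarrow>
     (\<forall>n. prob_space (X n) \<and> sets (X n) = sets (vec_space n)) \<and>
     (\<forall>\<epsilon>>0. (\<lambda>n. \<P>(x in X n. \<bar>L2_set x {..<n} - 1\<bar> > \<epsilon>)) \<longlonglongrightarrow> 0)"

text \<open>
  The noise is generated by its strictly upper triangular entries, which are i.i.d. with law \<open>P\<close>;
  the product measure makes it independent of the spike.
\<close>

definition wigner_noise :: "nat \<Rightarrow> real measure \<Rightarrow> (nat \<times> nat \<Rightarrow> real) measure" where
  "wigner_noise n P = PiM {(i, j). i < j \<and> j < n} (\<lambda>_. P)"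

definition spiked_matrix ::
    "nat \<Rightarrow> real \<Rightarrow> (nat \<Rightarrow> real) \<Rightarrow> (nat \<times> nat \<Rightarrow> real) \<Rightarrow> nat \<times> nat \<Rightarrow> real" where
  "spiked_matrix n l x w = (\<lambda>(i, j) \<in> {..<n} \<times> {..<n}.
     if i = j then 0 else l * x i * x j + 1 / sqrt n * w (min i j, max i j))"

definition Wig ::
    "nat \<Rightarrow> real \<Rightarrow> real measure \<Rightarrow> (nat \<Rightarrow> (nat \<Rightarrow> real) measure) \<Rightarrow> (nat \<times> nat \<Rightarrow> real) measure" where
  "Wig n l P X = distr (X n \<Otimes>\<^sub>M wigner_noise n P) (mat_space n) (\<lambda>(x, w). spiked_matrix n l x w)"

definition contiguous :: "(nat \<Rightarrow> 'a measure) \<Rightarrow> (nat \<Rightarrow> 'a measure) \<Rightarrow> bool" where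
  "contiguous P Q \<longleftrightarrow>
     (\<forall>A. (\<forall>n. A n \<in> sets (Q n)) \<longrightarrow> (\<lambda>n. measure (Q n) (A n)) \<longlonglongrightarrow> 0 \<longrightarrow>
          (\<lambda>n. measure (P n) (A n)) \<longlonglongrightarrow> 0)"

text \<open>
  The second moment is an extended nonnegative integral, so it may be infinite for some \<open>n\<close>;
  boundedness as \<open>n \<rightarrow> \<infinity>\<close> constrains only large \<open>n\<close>.  The threshold is an extended real, so that
  the supremum always exists.
\<close>

definition gaussian_second_moment :: "(nat \<Rightarrow> (nat \<Rightarrow> real) measure) \<Rightarrow> real \<Rightarrow> nat \<Rightarrow> ennreal" where
  "gaussian_second_moment X l n =
     (\<integral>\<^sup>+ (x, x'). ennreal (exp (l\<^sup>2 * n / 2 * (\<Sum>i<n. x i * x' i)\<^sup>2)) \<partial>(X n \<Otimes>\<^sub>M X n))"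

definition gaussian_threshold :: "(nat \<Rightarrow> (nat \<Rightarrow> real) measure) \<Rightarrow> ereal" where
  "gaussian_threshold X =
     (SUP l \<in> {l. 0 \<le> l \<and>
        (\<exists>C::real. \<forall>\<^sub>F n in sequentially. gaussian_second_moment X l n \<le> ennreal C)}. ereal l)"

text \<open>
  In the next three definitions, \<open>p\<close> is the density of \<open>P\<close>.  The integrals are Bochner integrals, so
  they are meaningful only for integrable integrands.  For the translation function this is a
  separate condition, \<open>translation_finite\<close>.  The Fisher information is automatically finite and
  positive for a positive differentiable density whose translation function \<open>\<tau>\<close> is finite and
  \<open>C\<^sup>2\<close> near \<open>(0, 0)\<close>: by Fatou, it is at most the lower limit as \<open>a \<rightarrow> 0\<close> of
  \<open>\<integral> (p(w - a) - p(w))\<^sup>2 / (a\<^sup>2 p(w)) dw = (exp (\<tau>(a, a)) - 1) / a\<^sup>2\<close>, where \<open>\<tau>(a, a)\<close> is minimal at \<open>0\<close>.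
\<close>

definition fisher_information :: "(real \<Rightarrow> real) \<Rightarrow> real" where
  "fisher_information p = (LINT w|lborel. (deriv p w)\<^sup>2 / p w)"

definition translation_finite :: "real measure \<Rightarrow> (real \<Rightarrow> real) \<Rightarrow> real \<times> real \<Rightarrow> bool" where
  "translation_finite P p = (\<lambda>(a, b). integrable P (\<lambda>z. p (z - a) / p z * (p (z - b) / p z)))"

definition translation_function :: "real measure \<Rightarrow> (real \<Rightarrow> real) \<Rightarrow> real \<times> real \<Rightarrow> real" where
  "translation_function P p = (\<lambda>(a, b). ln (LINT z|P. p (z - a) / p z * (p (z - b) / p z)))"

text \<open>
  The recursive characterization of \<open>C\<^sup>k\<close> functions on an open set \<open>U\<close>, through directional derivatives;
  it is meant for open \<open>U\<close> only.
\<close>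

primrec Ck_on ::
    "nat \<Rightarrow> ('a::real_normed_vector \<Rightarrow> 'b::real_normed_vector) \<Rightarrow> 'a set \<Rightarrow> bool" where
  "Ck_on 0 f U \<longleftrightarrow> continuous_on U f"
| "Ck_on (Suc k) f U \<longleftrightarrow>
     (\<forall>z\<in>U. f differentiable (at z)) \<and> (\<forall>v. Ck_on k (\<lambda>z. frechet_derivative f (at z) v) U)"

end

theory Submission imports Defs
begin

text \<open>
  Truncated second moment method.  On the event that the entries of \<open>x\<close> are below \<open>n powr (- 1 / 3)\<close> and that
  \<open>\<Sum> x\<^sub>i\<^sup>4 = O(1/n)\<close>, the second moment of the likelihood ratio is the expectation over two independent spikes of
  \<open>exp (\<Sum>\<^sub>i\<^sub><\<^sub>j \<tau>(a\<^sub>i\<^sub>j, b\<^sub>i\<^sub>j))\<close>, where \<open>a\<^sub>i\<^sub>j = \<lambda>\<surd>n x\<^sub>i x\<^sub>j\<close> and \<open>b\<^sub>i\<^sub>j = \<lambda>\<surd>n x'\<^sub>i x'\<^sub>j\<close> tend to \<open>0\<close> uniformly.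
  Since \<open>\<tau>\<close> is even and vanishes on both axes, \<open>\<tau>(a, b) = c a b + O(a\<^sup>4 + b\<^sup>4)\<close> near the origin.
  The quartic terms add up to \<open>O(\<lambda>\<^sup>4 n\<^sup>2 (\<Sum> x\<^sub>i\<^sup>4)\<^sup>2) = O(1)\<close> and the products to at most
  \<open>c \<lambda>\<^sup>2 n/2 \<langle>x, x'\<rangle>\<^sup>2\<close>, so the Gaussian second moment at \<open>\<lambda>\<surd>c\<close> controls everything.  Finally
  \<open>c\<close> is at most the Fisher information, as the difference quotients of \<open>p(z - a)/p(z)\<close> at \<open>a = 0\<close> converge in
  \<open>L\<^sup>2(P)\<close> to the score.
\<close>

subsection \<open>Taylor expansion of even functions of two variables\<close>

text \<open>The direction comes first so that \<open>dir_deriv v ^^ m\<close> is the m-fold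
  derivative along a fixed direction. Where \<open>f\<close> is not differentiable the value is an
  arbitrary one, so the algebraic rules below ask for differentiability or for a smoothness
  class.\<close>

definition dir_deriv :: "'a::real_normed_vector \<Rightarrow> ('a \<Rightarrow> 'b::real_normed_vector) \<Rightarrow> 'a \<Rightarrow> 'b" where
  "dir_deriv v f = (\<lambda>z. frechet_derivative f (at z) v)"

lemma Ck_on_Suc_dir_deriv:
  "Ck_on (Suc k) f U \<longleftrightarrow> (\<forall>z\<in>U. f differentiable (at z)) \<and> (\<forall>v. Ck_on k (dir_deriv v f) U)"
  by (simp add: dir_deriv_def)

lemma Ck_on_le:
  assumes "m \<le> n" "Ck_on n f U"
  shows "Ck_on m f U"
proof -
  have "Ck_on (Suc k) f U \<Longrightarrow> Ck_on k f U" for k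
  proof (induction k arbitrary: f)
    case 0
    then show ?case
      by (auto intro!: continuous_at_imp_continuous_on differentiable_imp_continuous_within)
  next
    case (Suc k)
    then show ?case by (metis Ck_on_Suc_dir_deriv)
  qed
  with assms show ?thesis by (induction rule: inc_induct) auto
qed

lemma Ck_on_funpow_dir_deriv:
  "Ck_on (m + k) f U \<Longrightarrow> Ck_on k ((dir_deriv v ^^ m) f) U"
proof (induction m arbitrary: f)
  case (Suc m)
  then have "Ck_on (m + k) (dir_deriv v f) U"
    by (simp add: Ck_on_Suc_dir_deriv del: Ck_on.simps)
  from Suc.IH[OF this] show ?case
    by (simp only: funpow_Suc_right o_apply)
qed simp

text \<open>\<open>frechet_derivative\<close> is a Hilbert choice among the derivatives. Near
  \<open>z\<close> both functions admit the same candidates, so the choices coincide even where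
  neither function is differentiable.\<close>

lemma dir_deriv_cong:
  assumes "open U" "\<And>z. z \<in> U \<Longrightarrow> f z = g z" "z \<in> U"
  shows "dir_deriv v f z = dir_deriv v g z"
proof -
  have "(f has_derivative f') (at z) \<longleftrightarrow> (g has_derivative f') (at z)" for f'
    using assms has_derivative_transform_within_open by metis
  then show ?thesis by (simp add: dir_deriv_def frechet_derivative_def)
qed

lemma funpow_dir_deriv_cong:
  assumes "open U" "\<And>z. z \<in> U \<Longrightarrow> f z = g z" "z \<in> U"
  shows "(dir_deriv v ^^ m) f z = (dir_deriv v ^^ m) g z"
  using assms(3)
proof (induction m arbitrary: z)
  case 0
  then show ?case by (simp add: assms(2))
next
  case (Suc m)
  then show ?case by (simp add: dir_deriv_cong[OF assms(1) Suc.IH])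
qed

lemma dir_deriv_linear:
  fixes f g :: "'a::real_normed_vector \<Rightarrow> real"
  assumes "f differentiable (at z)" "g differentiable (at z)"
  shows "dir_deriv v (\<lambda>z. a * f z + b * g z) z = a * dir_deriv v f z + b * dir_deriv v g z"
proof -
  have "((\<lambda>z. a * f z + b * g z) has_derivative
      (\<lambda>v. a * frechet_derivative f (at z) v + b * frechet_derivative g (at z) v)) (at z)"
    using assms by (auto intro!: derivative_eq_intros simp: frechet_derivative_works[symmetric])
  from frechet_derivative_at[OF this] show ?thesis
    by (simp add: dir_deriv_def fun_eq_iff)
qed

text \<open>The induction removes the innermost derivative, for which linearity holds throughout
  \<open>U\<close>. \<open>funpow_dir_deriv_cong\<close> carries that identity under the remaining
  \<open>m\<close> derivatives, and the induction hypothesis is applied to the first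
  derivatives.\<close>

lemma funpow_dir_deriv_linear:
  fixes f g :: "'a::real_normed_vector \<Rightarrow> real"
  assumes "open U"
  shows "Ck_on m f U \<Longrightarrow> Ck_on m g U \<Longrightarrow> z \<in> U \<Longrightarrow>
    (dir_deriv v ^^ m) (\<lambda>z. a * f z + b * g z) z
      = a * (dir_deriv v ^^ m) f z + b * (dir_deriv v ^^ m) g z"
proof (induction m arbitrary: f g)
  case (Suc m)
  have f: "\<And>z. z \<in> U \<Longrightarrow> f differentiable (at z)" "Ck_on m (dir_deriv v f) U"
    using Suc.prems(1) by (auto simp: Ck_on_Suc_dir_deriv simp del: Ck_on.simps)
  have g: "\<And>z. z \<in> U \<Longrightarrow> g differentiable (at z)" "Ck_on m (dir_deriv v g) U"
    using Suc.prems(2) by (auto simp: Ck_on_Suc_dir_deriv simp del: Ck_on.simps)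
  have "(dir_deriv v ^^ m) (dir_deriv v (\<lambda>z. a * f z + b * g z)) z
      = (dir_deriv v ^^ m) (\<lambda>z. a * dir_deriv v f z + b * dir_deriv v g z) z"
    by (rule funpow_dir_deriv_cong[OF assms _ Suc.prems(3)]) (simp add: dir_deriv_linear f g)
  also have "\<dots> = a * (dir_deriv v ^^ m) (dir_deriv v f) z + b * (dir_deriv v ^^ m) (dir_deriv v g) z"
    by (rule Suc.IH[OF f(2) g(2) Suc.prems(3)])
  finally show ?case by (simp only: funpow_Suc_right o_apply)
qed simp

lemma dir_deriv_Pair:
  fixes f :: "real \<times> real \<Rightarrow> real"
  assumes "f differentiable (at z)"
  shows "dir_deriv (a, b) f z = a * dir_deriv (1, 0) f z + b * dir_deriv (0, 1) f z"
proof -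
  have "linear (frechet_derivative f (at z))"
    using assms linear_frechet_derivative by blast
  from linear_add[OF this, of "a *\<^sub>R (1, 0)" "b *\<^sub>R (0, 1)"] show ?thesis
    using linear_scale[OF \<open>linear _\<close>, of a "(1, 0)"] linear_scale[OF \<open>linear _\<close>, of b "(0, 1)"]
    by (simp add: dir_deriv_def)
qed

text \<open>Only the innermost derivative is resolved into coordinates; the outer ones keep the
  direction \<open>(a, b)\<close>. In this shape an induction over \<open>m\<close> with varying
  \<open>f\<close> can continue.\<close>

lemma funpow_dir_deriv_Pair:
  fixes f :: "real \<times> real \<Rightarrow> real"
  assumes U: "open U" "z \<in> U" and f: "Ck_on (Suc m) f U"
  shows "(dir_deriv (a, b) ^^ Suc m) f z
    = a * (dir_deriv (a, b) ^^ m) (dir_deriv (1, 0) f) z + b * (dir_deriv (a, b) ^^ m) (dir_deriv (0, 1) f) z"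
proof -
  have d: "\<And>z. z \<in> U \<Longrightarrow> f differentiable (at z)" "\<And>v. Ck_on m (dir_deriv v f) U"
    using f by (auto simp: Ck_on_Suc_dir_deriv simp del: Ck_on.simps)
  have "(dir_deriv (a, b) ^^ Suc m) f z = (dir_deriv (a, b) ^^ m) (dir_deriv (a, b) f) z"
    by (simp only: funpow_Suc_right o_apply)
  also have "\<dots> = (dir_deriv (a, b) ^^ m) (\<lambda>z. a * dir_deriv (1, 0) f z + b * dir_deriv (0, 1) f z) z"
    by (rule funpow_dir_deriv_cong[OF U(1) _ U(2)]) (rule dir_deriv_Pair[OF d(1)])
  finally show ?thesis
    by (simp add: funpow_dir_deriv_linear[OF U(1) d(2) d(2) U(2)])
qed

text \<open>One constant serves all base points in \<open>K\<close> and all directions: compactness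
  gives it for \<open>m = 0\<close>, and each derivative resolved by
  \<open>funpow_dir_deriv_Pair\<close> contributes one factor
  \<open>\<bar>a\<bar> + \<bar>b\<bar>\<close>.\<close>

lemma funpow_dir_deriv_bound:
  fixes f :: "real \<times> real \<Rightarrow> real"
  assumes U: "open U" and K: "compact K" "K \<subseteq> U"
  shows "Ck_on m f U \<Longrightarrow> \<exists>C\<ge>0. \<forall>z\<in>K. \<forall>a b. \<bar>(dir_deriv (a, b) ^^ m) f z\<bar> \<le> C * (\<bar>a\<bar> + \<bar>b\<bar>) ^ m"
proof (induction m arbitrary: f)
  case 0
  then have "continuous_on K f" using K by (auto intro: continuous_on_subset)
  then have "bounded (f ` K)" using K(1) compact_continuous_image compact_imp_bounded by blast
  then obtain C where "\<forall>z\<in>K. \<bar>f z\<bar> \<le> C" by (auto simp: bounded_iff)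
  then show ?case by (intro exI[of _ "max C 0"]) auto
next
  case (Suc m)
  have d: "\<And>v. Ck_on m (dir_deriv v f) U"
    using Suc.prems by (auto simp: Ck_on_Suc_dir_deriv simp del: Ck_on.simps)
  obtain C1 where C1: "C1 \<ge> 0"
    "\<And>z a b. z \<in> K \<Longrightarrow> \<bar>(dir_deriv (a, b) ^^ m) (dir_deriv (1, 0) f) z\<bar> \<le> C1 * (\<bar>a\<bar> + \<bar>b\<bar>) ^ m"
    using Suc.IH[OF d] by meson
  obtain C2 where C2: "C2 \<ge> 0"
    "\<And>z a b. z \<in> K \<Longrightarrow> \<bar>(dir_deriv (a, b) ^^ m) (dir_deriv (0, 1) f) z\<bar> \<le> C2 * (\<bar>a\<bar> + \<bar>b\<bar>) ^ m"
    using Suc.IH[OF d] by meson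
  have "\<bar>(dir_deriv (a, b) ^^ Suc m) f z\<bar> \<le> (C1 + C2) * (\<bar>a\<bar> + \<bar>b\<bar>) ^ Suc m" if z: "z \<in> K" for z a b
  proof -
    have "\<bar>(dir_deriv (a, b) ^^ Suc m) f z\<bar> \<le> \<bar>a\<bar> * \<bar>(dir_deriv (a, b) ^^ m) (dir_deriv (1, 0) f) z\<bar>
        + \<bar>b\<bar> * \<bar>(dir_deriv (a, b) ^^ m) (dir_deriv (0, 1) f) z\<bar>"
      using z K(2) by (subst funpow_dir_deriv_Pair[OF U _ Suc.prems]) (auto simp: abs_mult[symmetric])
    also have "\<dots> \<le> (\<bar>a\<bar> + \<bar>b\<bar>) * (C1 * (\<bar>a\<bar> + \<bar>b\<bar>) ^ m) + (\<bar>a\<bar> + \<bar>b\<bar>) * (C2 * (\<bar>a\<bar> + \<bar>b\<bar>) ^ m)"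
      using C1 C2 z by (intro add_mono mult_mono) auto
    finally show ?thesis by (simp add: algebra_simps)
  qed
  then show ?case using C1(1) C2(1) by (intro exI[of _ "C1 + C2"]) auto
qed

lemma funpow_dir_deriv_on_line:
  fixes f :: "'a::real_normed_vector \<Rightarrow> real"
  assumes f: "Ck_on (Suc m) f U" and z: "z + t *\<^sub>R v \<in> U"
  shows "((\<lambda>s. (dir_deriv v ^^ m) f (z + s *\<^sub>R v)) has_real_derivative
      (dir_deriv v ^^ Suc m) f (z + t *\<^sub>R v)) (at t)"
proof -
  let ?h = "(dir_deriv v ^^ m) f"
  have "Ck_on 1 ?h U" using f by (intro Ck_on_funpow_dir_deriv) simp
  then have "?h differentiable (at (z + t *\<^sub>R v))" using z by simp
  then have "(?h has_derivative frechet_derivative ?h (at (z + t *\<^sub>R v))) (at (z + t *\<^sub>R v))"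
    and lin: "linear (frechet_derivative ?h (at (z + t *\<^sub>R v)))"
    by (simp_all add: frechet_derivative_works[symmetric] linear_frechet_derivative)
  moreover have "((\<lambda>s. z + s *\<^sub>R v) has_derivative (\<lambda>s. s *\<^sub>R v)) (at t)"
    by (auto intro!: derivative_eq_intros)
  ultimately have "((\<lambda>s. ?h (z + s *\<^sub>R v)) has_derivative
      (\<lambda>s. frechet_derivative ?h (at (z + t *\<^sub>R v)) (s *\<^sub>R v))) (at t)"
    using has_derivative_compose[of "\<lambda>s. z + s *\<^sub>R v" "\<lambda>s. s *\<^sub>R v" t UNIV ?h] by blast
  moreover have "(\<lambda>s. frechet_derivative ?h (at (z + t *\<^sub>R v)) (s *\<^sub>R v))
      = (*) ((dir_deriv v ^^ Suc m) f (z + t *\<^sub>R v))"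
    by (simp add: fun_eq_iff linear_scale[OF lin] dir_deriv_def)
  ultimately show ?thesis by (simp only: has_field_derivative_def)
qed

text \<open>Taylor's formula with Lagrange remainder, applied to the symmetrized restriction of
  \<open>f\<close> to the line through \<open>v\<close>. Symmetrization cancels the odd orders, so
  the first error is of order four. Evenness is asked for at \<open>v\<close> only.\<close>

lemma even_taylor:
  fixes f :: "'a::real_normed_vector \<Rightarrow> real"
  assumes f: "Ck_on 4 f U" and sub: "\<And>t. \<bar>t\<bar> \<le> 1 \<Longrightarrow> t *\<^sub>R v \<in> U"
    and even: "f (- v) = f v"
    and bound: "\<And>t. \<bar>t\<bar> \<le> 1 \<Longrightarrow> \<bar>(dir_deriv v ^^ 4) f (t *\<^sub>R v)\<bar> \<le> B"
  shows "\<bar>f v - f 0 - (dir_deriv v ^^ 2) f 0 / 2\<bar> \<le> B / 24"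
proof -
  define g where "g m t = (dir_deriv v ^^ m) f (t *\<^sub>R v)" for m t
  \<comment> \<open>\<open>h m\<close> is the m-th derivative of \<open>f (t v) + f (- t v)\<close>
    in \<open>t\<close>; it vanishes at \<open>0\<close> for odd \<open>m\<close>.\<close>
  define h where "h m t = g m t + (-1) ^ m * g m (- t)" for m t
  have g: "(g m has_real_derivative g (Suc m) t) (at t)" if "m < 4" "\<bar>t\<bar> \<le> 1" for m t
  proof -
    have "Ck_on (Suc m) f U" using that(1) by (intro Ck_on_le[OF _ f]) simp
    from funpow_dir_deriv_on_line[OF this, of 0 t v] show ?thesis
      using sub[OF that(2)] by (simp add: g_def[abs_def])
  qed
  have "(h m has_real_derivative h (Suc m) t) (at t)" if "m < 4" "0 \<le> t" "t \<le> 1" for m t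
  proof -
    have "((\<lambda>t. g m (- t)) has_real_derivative - g (Suc m) (- t)) (at t)"
      using DERIV_chain2[OF g[OF that(1), of "- t"] DERIV_minus[OF DERIV_ident, of t]] that by simp
    from DERIV_add[OF g[OF that(1)] DERIV_cmult[OF this, of "(-1) ^ m"]] show ?thesis
      using that by (simp add: h_def[abs_def])
  qed
  then have "\<exists>t>0. t < 1 \<and> h 0 1 = (\<Sum>m<4. h m 0 / fact m * 1 ^ m) + h 4 t / fact 4 * 1 ^ 4"
    by (intro Maclaurin) auto
  then obtain t where t: "0 < t" "t < 1" "h 0 1 = (\<Sum>m<4. h m 0 / fact m * 1 ^ m) + h 4 t / fact 4 * 1 ^ 4"
    by blast
  have "(\<Sum>m<4. h m 0 / fact m * 1 ^ m) = 2 * f 0 + (dir_deriv v ^^ 2) f 0"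
    by (simp add: h_def g_def eval_nat_numeral)
  moreover have "h 0 1 = 2 * f v" by (simp add: h_def g_def even)
  moreover have "fact 4 = (24::real)" by (simp add: eval_nat_numeral)
  \<comment> \<open>The factor \<open>48\<close> is \<open>2 * fact 4\<close>, because
    \<open>h 0 1\<close> counts \<open>f v\<close> twice.\<close>
  ultimately have "f v - f 0 - (dir_deriv v ^^ 2) f 0 / 2 = h 4 t / 48" using t(3) by (simp add: field_simps)
  moreover have "\<bar>h 4 t\<bar> \<le> 2 * B"
    using bound[of t] bound[of "- t"] t by (simp add: h_def g_def)
  ultimately show ?thesis by linarith
qed

lemma sum_pow4_le: "(\<bar>a\<bar> + \<bar>b\<bar>) ^ 4 \<le> 8 * (a ^ 4 + b ^ 4)" for a b :: real
proof -
  have s: "(x + y)\<^sup>2 \<le> 2 * (x\<^sup>2 + y\<^sup>2)" for x y :: real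
    using sum_squares_bound[of x y] by (simp add: power2_sum)
  have "((\<bar>a\<bar> + \<bar>b\<bar>)\<^sup>2)\<^sup>2 \<le> (2 * (a\<^sup>2 + b\<^sup>2))\<^sup>2"
    using s[of "\<bar>a\<bar>" "\<bar>b\<bar>"] by (intro power_mono) auto
  also have "\<dots> \<le> 8 * ((a\<^sup>2)\<^sup>2 + (b\<^sup>2)\<^sup>2)"
    using s[of "a\<^sup>2" "b\<^sup>2"] unfolding power_mult_distrib by simp
  finally show ?thesis by simp
qed

text \<open>A version of \<open>even_taylor\<close> uniform on a square: compactness of a ball gives
  one constant for all directions, and the second derivative along \<open>(a, b)\<close> is written
  as a quadratic form. Both mixed partial derivatives appear, since nothing identifies them at this
  point.\<close>

lemma even_taylor_Pair:
  fixes f :: "real \<times> real \<Rightarrow> real"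
  assumes U: "open U" "(0, 0) \<in> U" and f: "Ck_on 4 f U"
    and even: "\<And>a b. (a, b) \<in> U \<Longrightarrow> f (- a, - b) = f (a, b)"
  obtains C r where "C \<ge> 0" "r > 0" "{-r<..<r} \<times> {-r<..<r} \<subseteq> U"
    "\<And>a b. \<bar>a\<bar> < r \<Longrightarrow> \<bar>b\<bar> < r \<Longrightarrow>
      \<bar>f (a, b) - f (0, 0) - (a\<^sup>2 * dir_deriv (1, 0) (dir_deriv (1, 0) f) (0, 0)
        + a * b * (dir_deriv (1, 0) (dir_deriv (0, 1) f) (0, 0) + dir_deriv (0, 1) (dir_deriv (1, 0) f) (0, 0))
        + b\<^sup>2 * dir_deriv (0, 1) (dir_deriv (0, 1) f) (0, 0)) / 2\<bar> \<le> C * (a ^ 4 + b ^ 4)"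
proof -
  obtain e where e: "e > 0" "cball (0, 0) e \<subseteq> U"
    using U open_contains_cball by blast
  define K where "K = cball (0::real \<times> real) e"
  have K: "compact K" "K \<subseteq> U" using e by (auto simp: K_def zero_prod_def)
  obtain C where C: "C \<ge> 0"
    "\<And>z a b. z \<in> K \<Longrightarrow> \<bar>(dir_deriv (a, b) ^^ 4) f z\<bar> \<le> C * (\<bar>a\<bar> + \<bar>b\<bar>) ^ 4"
    using funpow_dir_deriv_bound[OF U(1) K f] by blast
  \<comment> \<open>Half the radius suffices: the Euclidean norm of \<open>(a, b)\<close> is at most
    \<open>\<bar>a\<bar> + \<bar>b\<bar>\<close>, hence below \<open>e\<close>.\<close>
  have small: "t *\<^sub>R (a, b) \<in> K" if "\<bar>a\<bar> < e / 2" "\<bar>b\<bar> < e / 2" "\<bar>t\<bar> \<le> 1" for a b t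
  proof -
    have "norm (t *\<^sub>R (a, b)) \<le> 1 * norm (a, b)"
      unfolding norm_scaleR using that(3) by (intro mult_right_mono) auto
    also have "\<dots> \<le> \<bar>a\<bar> + \<bar>b\<bar>" using norm_Pair_le[of a b] by simp
    finally show ?thesis using that by (simp add: K_def)
  qed
  have d: "\<And>z. z \<in> U \<Longrightarrow> f differentiable (at z)" "\<And>v. Ck_on 3 (dir_deriv v f) U"
    using f Ck_on_Suc_dir_deriv[of 3 f U] by (auto simp del: Ck_on.simps)
  have d': "dir_deriv v f differentiable (at (0, 0))" for v
    using d(2)[of v] Ck_on_Suc_dir_deriv[of 2 "dir_deriv v f" U] U(2) by (auto simp del: Ck_on.simps)
  show ?thesis
  \<comment> \<open>\<open>C / 3\<close> is \<open>8 * C / 24\<close>: the \<open>8\<close> comes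
    from \<open>sum_pow4_le\<close>, the \<open>24\<close> from the remainder in
    \<open>even_taylor\<close>.\<close>
  proof (rule that[of "C / 3" "e / 2"])
    show "C / 3 \<ge> 0" "e / 2 > 0" using C e by auto
    show "{- (e / 2)<..<e / 2} \<times> {- (e / 2)<..<e / 2} \<subseteq> U"
      using small[of _ _ 1] K(2) by (force simp: abs_less_iff)
  next
    fix a b :: real assume ab: "\<bar>a\<bar> < e / 2" "\<bar>b\<bar> < e / 2"
    have "(dir_deriv (a, b) ^^ 2) f (0, 0)
        = dir_deriv (a, b) (\<lambda>z. a * dir_deriv (1, 0) f z + b * dir_deriv (0, 1) f z) (0, 0)"
      unfolding numeral_2_eq_2 funpow.simps o_apply id_apply
      by (rule dir_deriv_cong[OF U(1) _ U(2)]) (rule dir_deriv_Pair[OF d(1)])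
    also have "\<dots> = a * dir_deriv (a, b) (dir_deriv (1, 0) f) (0, 0) + b * dir_deriv (a, b) (dir_deriv (0, 1) f) (0, 0)"
      by (rule dir_deriv_linear[OF d' d'])
    finally have 2: "(dir_deriv (a, b) ^^ 2) f (0, 0) = a\<^sup>2 * dir_deriv (1, 0) (dir_deriv (1, 0) f) (0, 0)
        + a * b * (dir_deriv (1, 0) (dir_deriv (0, 1) f) (0, 0) + dir_deriv (0, 1) (dir_deriv (1, 0) f) (0, 0))
        + b\<^sup>2 * dir_deriv (0, 1) (dir_deriv (0, 1) f) (0, 0)"
      by (simp add: dir_deriv_Pair[OF d', of a b] algebra_simps power2_eq_square)
    have "\<bar>f (a, b) - f 0 - (dir_deriv (a, b) ^^ 2) f 0 / 2\<bar> \<le> C * (\<bar>a\<bar> + \<bar>b\<bar>) ^ 4 / 24"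
    proof (rule even_taylor[OF f])
      show "t *\<^sub>R (a, b) \<in> U" if "\<bar>t\<bar> \<le> 1" for t using small[OF ab that] K by auto
      show "f (- (a, b)) = f (a, b)" using even[of a b] small[OF ab, of 1] K(2) by auto
      show "\<bar>(dir_deriv (a, b) ^^ 4) f (t *\<^sub>R (a, b))\<bar> \<le> C * (\<bar>a\<bar> + \<bar>b\<bar>) ^ 4" if "\<bar>t\<bar> \<le> 1" for t
        using C(2)[OF small[OF ab that]] .
    qed
    also have "\<dots> \<le> C * (8 * (a ^ 4 + b ^ 4)) / 24"
      using C(1) sum_pow4_le by (intro divide_right_mono mult_left_mono) auto
    finally show "\<bar>f (a, b) - f (0, 0) - (a\<^sup>2 * dir_deriv (1, 0) (dir_deriv (1, 0) f) (0, 0)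
        + a * b * (dir_deriv (1, 0) (dir_deriv (0, 1) f) (0, 0) + dir_deriv (0, 1) (dir_deriv (1, 0) f) (0, 0))
        + b\<^sup>2 * dir_deriv (0, 1) (dir_deriv (0, 1) f) (0, 0)) / 2\<bar> \<le> C / 3 * (a ^ 4 + b ^ 4)"
      by (simp add: 2[unfolded zero_prod_def[symmetric]] zero_prod_def[symmetric] algebra_simps)
  qed
qed

subsection \<open>The translation function and the Fisher information\<close>

text \<open>The set where two continuous functions differ is open, and a nonempty open set is not
  negligible.\<close>

lemma continuous_AE_eq_imp_eq:
  fixes f g :: "real \<Rightarrow> real"
  assumes "continuous_on UNIV f" "continuous_on UNIV g" "AE x in lborel. f x = g x"
  shows "f = g"
proof (rule ccontr)
  assume "f \<noteq> g"
  define S where "S = {x. f x \<noteq> g x}"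
  have "open S" "S \<noteq> {}"
    using assms \<open>f \<noteq> g\<close> by (auto simp: S_def intro!: open_Collect_neq)
  have "S \<in> null_sets lborel"
    using assms(3) \<open>open S\<close> by (subst AE_iff_null_sets) (auto simp: S_def)
  then have "negligible S"
    by (simp add: negligible_iff_null_sets null_sets_completionI)
  with open_not_negligible \<open>open S\<close> \<open>S \<noteq> {}\<close> show False by blast
qed

section \<open>Positive densities, likelihood ratios of translates and the translation
  function\<close>

locale positive_density =
  fixes P :: "real measure" and p :: "real \<Rightarrow> real"
  assumes prob: "prob_space P"
    and P_density: "P = density lborel (\<lambda>w. ennreal (p w))"
    and p_differentiable: "\<And>w. p differentiable (at w)"
    and p_pos: "\<And>w. p w > 0"
begin

sublocale prob_space P by (fact prob)

abbreviation \<tau> :: "real \<Rightarrow> real \<Rightarrow> real" where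
  "\<tau> a b \<equiv> translation_function P p (a, b)"

text \<open>The density, with respect to \<open>P\<close>, of the law \<open>P\<close> translated by
  \<open>a\<close>; see \<open>distr_P_translation\<close>.\<close>

definition ratio :: "real \<Rightarrow> real \<Rightarrow> real" where
  "ratio a z = p (z - a) / p z"

lemma p_nonneg [simp]: "p w \<ge> 0" and p_nonzero [simp]: "p w \<noteq> 0"
  using p_pos[of w] by auto

lemma ratio_nonneg [simp]: "ratio a z \<ge> 0" and ratio_pos: "ratio a z > 0" and ratio_0 [simp]: "ratio 0 z = 1"
  using p_pos by (auto simp: ratio_def)

lemma sets_P [simp, measurable_cong]: "sets P = sets borel" and space_P [simp]: "space P = UNIV"
  by (simp_all add: P_density)

lemma p_continuous: "continuous_on UNIV p"
  by (simp add: continuous_at_imp_continuous_on differentiable_imp_continuous_within p_differentiable)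

lemma p_measurable [measurable]: "p \<in> borel_measurable borel"
  using p_continuous by (rule borel_measurable_continuous_onI)

lemma ratio_measurable [measurable]: "ratio a \<in> borel_measurable borel"
  unfolding ratio_def[abs_def] by measurable

lemma integral_P:
  fixes f :: "real \<Rightarrow> real"
  assumes [measurable]: "f \<in> borel_measurable borel"
  shows "(\<integral>z. f z \<partial>P) = (\<integral>z. p z * f z \<partial>lborel)"
    and "integrable P f \<longleftrightarrow> integrable lborel (\<lambda>z. p z * f z)"
  by (simp_all add: P_density integral_density integrable_density)

lemma p_integrable: "integrable lborel p" and p_integral: "(\<integral>z. p z \<partial>lborel) = 1"
proof -
  show "integrable lborel p" using integral_P(2)[of "\<lambda>_. 1"] by simp
  show "(\<integral>z. p z \<partial>lborel) = 1" using integral_P(1)[of "\<lambda>_. 1"] prob_space by simp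
qed

lemma ratio_integrable: "integrable P (ratio a)" and ratio_integral: "(\<integral>z. ratio a z \<partial>P) = 1"
proof -
  \<comment> \<open>The form \<open>- a + 1 * z\<close> matches the affine substitution rules for
    \<open>lborel\<close>.\<close>
  have *: "p z * ratio a z = p (- a + 1 * z)" for z by (simp add: ratio_def add.commute)
  show "integrable P (ratio a)"
    unfolding integral_P(2)[OF ratio_measurable] *
    using lborel_integrable_real_affine_iff[of 1 p "- a"] p_integrable by simp
  show "(\<integral>z. ratio a z \<partial>P) = 1"
    unfolding integral_P(1)[OF ratio_measurable] *
    using lborel_integral_real_affine[of 1 p "- a"] p_integral by simp
qed

lemma translation_finite_ratio:
  "translation_finite P p (a, b) \<longleftrightarrow> integrable P (\<lambda>z. ratio a z * ratio b z)"
  by (simp add: translation_finite_def ratio_def)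

lemma translation_function_ratio: "\<tau> a b = ln (\<integral>z. ratio a z * ratio b z \<partial>P)"
  by (simp add: translation_function_def ratio_def)

lemma translation_function_0 [simp]: "\<tau> a 0 = 0" "\<tau> 0 a = 0"
  by (simp_all add: translation_function_ratio ratio_integral)

lemma translation_function_commute: "\<tau> a b = \<tau> b a"
  by (simp add: translation_function_ratio mult.commute)

text \<open>\<open>exp\<close> undoes \<open>ln\<close> only at positive arguments. The integral
  cannot vanish, since both ratios are positive everywhere and \<open>P\<close> has mass
  one.\<close>

lemma exp_translation_function:
  assumes "translation_finite P p (a, b)"
  shows "exp (\<tau> a b) = (\<integral>z. ratio a z * ratio b z \<partial>P)"
proof -
  have int: "integrable P (\<lambda>z. ratio a z * ratio b z)"
    using assms by (simp add: translation_finite_ratio)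
  have "(\<integral>z. ratio a z * ratio b z \<partial>P) \<noteq> 0"
  proof
    assume "(\<integral>z. ratio a z * ratio b z \<partial>P) = 0"
    then have "AE z in P. ratio a z * ratio b z = 0"
      by (subst (asm) integral_nonneg_eq_0_iff_AE[OF int]) auto
    then have "AE z in P. False"
      by eventually_elim (use ratio_pos in \<open>auto simp: less_le\<close>)
    then show False by simp
  qed
  moreover have "(\<integral>z. ratio a z * ratio b z \<partial>P) \<ge> 0"
    by (intro Bochner_Integration.integral_nonneg) auto
  ultimately show ?thesis by (simp add: translation_function_ratio less_le)
qed

text \<open>The ratios have mean one under \<open>P\<close>, so \<open>exp (\<tau> a b) - 1\<close>
  is their covariance.\<close>

lemma
  assumes "translation_finite P p (a, b)"
  shows integrable_centered_ratio: "integrable P (\<lambda>z. (ratio a z - 1) * (ratio b z - 1))"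
    and integral_centered_ratio: "(\<integral>z. (ratio a z - 1) * (ratio b z - 1) \<partial>P) = exp (\<tau> a b) - 1"
proof -
  have int: "integrable P (\<lambda>z. ratio a z * ratio b z)"
    using assms by (simp add: translation_finite_ratio)
  have *: "(ratio a z - 1) * (ratio b z - 1) = ratio a z * ratio b z - ratio a z - ratio b z + 1" for z
    by (simp add: algebra_simps)
  show "integrable P (\<lambda>z. (ratio a z - 1) * (ratio b z - 1))"
    unfolding * using int by (simp add: ratio_integrable)
  show "(\<integral>z. (ratio a z - 1) * (ratio b z - 1) \<partial>P) = exp (\<tau> a b) - 1"
    unfolding * using int assms prob_space
    by (simp add: ratio_integrable ratio_integral exp_translation_function)
qed

text \<open>Equal measures determine densities only almost everywhere; continuity of
  \<open>p\<close> upgrades this to every point.\<close>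

lemma p_even:
  assumes "distr P borel uminus = P"
  shows "p (- w) = p w"
proof -
  have "density lborel (\<lambda>w. ennreal (p (- w))) = distr P borel uminus"
  proof (rule measure_eqI)
    fix A :: "real set" assume "A \<in> sets (density lborel (\<lambda>w. ennreal (p (- w))))"
    then have A [measurable]: "A \<in> sets borel" by simp
    have "emeasure (distr P borel uminus) A = emeasure P (uminus -` A)"
      by (subst emeasure_distr) (auto simp: measurable_cong_sets[OF sets_P refl])
    also have "\<dots> = (\<integral>\<^sup>+z. ennreal (p z) * indicator A (- z) \<partial>lborel)"
      unfolding P_density using measurable_sets[of uminus borel borel A]
      by (subst emeasure_density) (auto simp: indicator_def intro!: nn_integral_cong)
    also have "\<dots> = (\<integral>\<^sup>+z. ennreal (p (- z)) * indicator A z \<partial>lborel)"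
      by (subst nn_integral_real_affine[of _ "-1" 0]) auto
    finally show "emeasure (density lborel (\<lambda>w. ennreal (p (- w)))) A = emeasure (distr P borel uminus) A"
      by (simp add: emeasure_density)
  qed simp
  then have "density lborel (\<lambda>w. ennreal (p (- w))) = density lborel (\<lambda>w. ennreal (p w))"
    using assms P_density by simp
  then have "AE w in lborel. ennreal (p (- w)) = ennreal (p w)"
    by (intro sigma_finite_measure.density_unique[OF sigma_finite_lborel]) auto
  then have "AE w in lborel. p (- w) = p w" by simp
  moreover have "continuous_on UNIV (\<lambda>w. p (- w))"
    by (intro continuous_on_compose2[OF p_continuous] continuous_intros) auto
  ultimately show ?thesis using continuous_AE_eq_imp_eq[OF _ p_continuous] by metis
qed

lemma translation_function_even:
  assumes "distr P borel uminus = P"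
  shows "\<tau> (- a) (- b) = \<tau> a b"
proof -
  note ev = p_even[OF assms]
  have "(\<integral>z. ratio (- a) z * ratio (- b) z \<partial>P) = (\<integral>z. p z * (ratio (- a) z * ratio (- b) z) \<partial>lborel)"
    by (simp add: integral_P)
  also have "\<dots> = (\<integral>z. p (- z) * (ratio (- a) (- z) * ratio (- b) (- z)) \<partial>lborel)"
    by (subst lborel_integral_real_affine[of "-1" _ 0]) auto
  also have "\<dots> = (\<integral>z. p z * (ratio a z * ratio b z) \<partial>lborel)"
  proof -
    have "ratio (- c) (- z) = ratio c z" for c z
      using ev[of "z - c"] ev[of z] by (simp add: ratio_def)
    then show ?thesis by (simp add: ev)
  qed
  also have "\<dots> = (\<integral>z. ratio a z * ratio b z \<partial>P)"
    by (simp add: integral_P)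
  finally show ?thesis by (simp add: translation_function_ratio)
qed

section \<open>The score and the difference quotients of the likelihood ratio\<close>

text \<open>The derivative of \<open>ratio a z\<close> in \<open>a\<close> at \<open>a = 0\<close>;
  the minus sign comes from the argument \<open>z - a\<close>.\<close>

definition score :: "real \<Rightarrow> real" where
  "score z = - deriv p z / p z"

definition ratio_quotient :: "real \<Rightarrow> real \<Rightarrow> real" where
  "ratio_quotient a z = (ratio a z - 1) / a"

lemma ratio_quotient_measurable [measurable]: "ratio_quotient a \<in> borel_measurable borel"
  unfolding ratio_quotient_def[abs_def] by measurable

lemma tendsto_ratio_quotient:
  assumes "filterlim b (at 0) F"
  shows "((\<lambda>m. ratio_quotient (b m) z) \<longlongrightarrow> score z) F"
proof -
  have "(p has_real_derivative deriv p z) (at z)"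
    using p_differentiable[of z] DERIV_deriv_iff_real_differentiable by blast
  then have "(p has_real_derivative deriv p z) (at (z - 0))" by simp
  then have "((\<lambda>a. p (z - a)) has_real_derivative - deriv p z) (at 0)"
    by (rule DERIV_chain2[where g = "\<lambda>a. z - a", THEN DERIV_cong]) (auto intro!: derivative_eq_intros)
  then have "((\<lambda>a. (p (z - a) - p z) / a) \<longlongrightarrow> - deriv p z) (at 0)"
    by (simp add: DERIV_def)
  from filterlim_compose[OF this assms] have "((\<lambda>m. (p (z - b m) - p z) / b m / p z) \<longlongrightarrow> score z) F"
    unfolding score_def by (intro tendsto_divide) auto
  moreover have "(p (z - a) - p z) / a / p z = ratio_quotient a z" for a
    by (simp add: ratio_quotient_def ratio_def field_simps)
  ultimately show ?thesis by simp
qed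

text \<open>Obtained as a pointwise limit of difference quotients, since \<open>deriv p\<close> need
  not be continuous.\<close>

lemma score_measurable [measurable]: "score \<in> borel_measurable borel"
proof (rule borel_measurable_LIMSEQ_real)
  have "filterlim (\<lambda>n. 1 / real (Suc n)) (at 0) sequentially"
    by real_asymp
  then show "(\<lambda>n. ratio_quotient (1 / real (Suc n)) z) \<longlonglongrightarrow> score z" for z
    by (rule tendsto_ratio_quotient)
qed measurable

lemma fisher_information_score: "fisher_information p = (\<integral>z. (score z)\<^sup>2 \<partial>P)"
proof -
  have "p z * (score z)\<^sup>2 = (deriv p z)\<^sup>2 / p z" for z
    by (simp add: score_def power2_eq_square field_simps)
  then show ?thesis by (simp add: fisher_information_def integral_P)
qed

lemma fisher_information_nonneg: "fisher_information p \<ge> 0"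
  by (simp add: fisher_information_score)

lemma
  assumes "translation_finite P p (a, a)" "a \<noteq> 0"
  shows integrable_ratio_quotient_sq: "integrable P (\<lambda>z. (ratio_quotient a z)\<^sup>2)"
    and integral_ratio_quotient_sq: "(\<integral>z. (ratio_quotient a z)\<^sup>2 \<partial>P) = (exp (\<tau> a a) - 1) / a\<^sup>2"
  using integrable_centered_ratio[OF assms(1)] integral_centered_ratio[OF assms(1)]
  by (simp_all add: ratio_quotient_def power2_eq_square)

text \<open>Expanding the square leaves three integrals that \<open>\<tau>\<close> determines. The
  cross term is divided by \<open>b\<close> first and by \<open>a\<close> afterwards, ready for the
  limit in \<open>b\<close> at fixed \<open>a\<close>.\<close>

lemma
  assumes fin: "translation_finite P p (a, a)" "translation_finite P p (a, b)" "translation_finite P p (b, b)"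
    and nz: "a \<noteq> 0" "b \<noteq> 0"
  shows integrable_ratio_quotient_diff: "integrable P (\<lambda>z. (ratio_quotient a z - ratio_quotient b z)\<^sup>2)"
    and integral_ratio_quotient_diff: "(\<integral>z. (ratio_quotient a z - ratio_quotient b z)\<^sup>2 \<partial>P)
      = (exp (\<tau> a a) - 1) / a\<^sup>2 - 2 * ((exp (\<tau> a b) - 1) / b) / a + (exp (\<tau> b b) - 1) / b\<^sup>2"
proof -
  have *: "(ratio_quotient a z - ratio_quotient b z)\<^sup>2
      = (ratio_quotient a z)\<^sup>2 - 2 / (a * b) * ((ratio a z - 1) * (ratio b z - 1)) + (ratio_quotient b z)\<^sup>2" for z
    by (simp add: ratio_quotient_def power2_diff)
  note i = integrable_ratio_quotient_sq[OF fin(1) nz(1)] integrable_ratio_quotient_sq[OF fin(3) nz(2)]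
    integrable_centered_ratio[OF fin(2)]
  show "integrable P (\<lambda>z. (ratio_quotient a z - ratio_quotient b z)\<^sup>2)"
    unfolding * by (intro Bochner_Integration.integrable_add Bochner_Integration.integrable_diff integrable_mult_right i)
  have "(\<integral>z. (ratio_quotient a z - ratio_quotient b z)\<^sup>2 \<partial>P) = (\<integral>z. (ratio_quotient a z)\<^sup>2 \<partial>P)
      - 2 / (a * b) * (\<integral>z. (ratio a z - 1) * (ratio b z - 1) \<partial>P) + (\<integral>z. (ratio_quotient b z)\<^sup>2 \<partial>P)"
    unfolding * using i by (simp add: Bochner_Integration.integral_add Bochner_Integration.integral_diff)
  then show "(\<integral>z. (ratio_quotient a z - ratio_quotient b z)\<^sup>2 \<partial>P)
      = (exp (\<tau> a a) - 1) / a\<^sup>2 - 2 * ((exp (\<tau> a b) - 1) / b) / a + (exp (\<tau> b b) - 1) / b\<^sup>2"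
    using fin nz by (simp add: integral_ratio_quotient_sq integral_centered_ratio mult.commute)
qed

end

text \<open>Writes \<open>exp y - 1\<close> as \<open>y * E y\<close> with \<open>E\<close>
  continuous at \<open>0\<close>; setting \<open>E 0 = 1\<close> keeps the identity true where
  \<open>f\<close> vanishes.\<close>

lemma exp_minus_one_quotient_tendsto:
  fixes f g :: "'a \<Rightarrow> real"
  assumes f: "(f \<longlongrightarrow> 0) F" and fg: "((\<lambda>x. f x / g x) \<longlongrightarrow> c) F"
  shows "((\<lambda>x. (exp (f x) - 1) / g x) \<longlongrightarrow> c) F"
proof -
  define E where "E x = (if x = 0 then 1 else (exp x - 1) / x)" for x :: real
  have "((\<lambda>x. (exp (0 + x) - exp 0) / x) \<longlongrightarrow> 1) (at (0::real))"
    using DERIV_exp[of "0::real"] by (simp add: DERIV_def)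
  then have "(E \<longlongrightarrow> 1) (at 0)"
    by (rule Lim_transform_eventually) (auto simp: E_def eventually_at_filter)
  then have "isCont E 0" by (simp add: isCont_def E_def)
  from isCont_tendsto_compose[OF this f] have "((\<lambda>x. E (f x)) \<longlongrightarrow> 1) F" by (simp add: E_def)
  from tendsto_mult[OF fg this] have "((\<lambda>x. f x / g x * E (f x)) \<longlongrightarrow> c) F" by simp
  also have "(\<lambda>x. f x / g x * E (f x)) = (\<lambda>x. (exp (f x) - 1) / g x)" by (simp add: E_def fun_eq_iff)
  finally show ?thesis .
qed

text \<open>Fatou's lemma for squares. The extended nonnegative integral is bounded first, because
  integrability of the limit is part of the conclusion.\<close>

lemma integral_square_limit_le:
  fixes f :: "nat \<Rightarrow> 'a \<Rightarrow> real"
  assumes [measurable]: "\<And>m. f m \<in> borel_measurable M"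
    and lim: "\<And>x. (\<lambda>m. f m x) \<longlonglongrightarrow> g x"
    and int: "\<And>m. integrable M (\<lambda>x. (f m x)\<^sup>2)" "(\<lambda>m. \<integral>x. (f m x)\<^sup>2 \<partial>M) \<longlonglongrightarrow> L"
  shows "integrable M (\<lambda>x. (g x)\<^sup>2)" "(\<integral>x. (g x)\<^sup>2 \<partial>M) \<le> L"
proof -
  have [measurable]: "g \<in> borel_measurable M"
    using lim by (rule borel_measurable_LIMSEQ_real) measurable
  have L: "L \<ge> 0" using int(2) by (rule LIMSEQ_le_const) auto
  have "(\<integral>\<^sup>+x. ennreal ((g x)\<^sup>2) \<partial>M) = (\<integral>\<^sup>+x. liminf (\<lambda>m. ennreal ((f m x)\<^sup>2)) \<partial>M)"
  proof (rule nn_integral_cong)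
    fix x
    have "(\<lambda>m. ennreal ((f m x)\<^sup>2)) \<longlonglongrightarrow> ennreal ((g x)\<^sup>2)"
      by (intro tendsto_ennrealI tendsto_power lim)
    then show "ennreal ((g x)\<^sup>2) = liminf (\<lambda>m. ennreal ((f m x)\<^sup>2))"
      by (intro lim_imp_Liminf[symmetric]) auto
  qed
  also have "\<dots> \<le> liminf (\<lambda>m. \<integral>\<^sup>+x. ennreal ((f m x)\<^sup>2) \<partial>M)"
    by (intro nn_integral_liminf) measurable
  also have "\<dots> = liminf (\<lambda>m. ennreal (\<integral>x. (f m x)\<^sup>2 \<partial>M))"
    using int(1) by (simp add: nn_integral_eq_integral)
  also have "\<dots> = ennreal L"
    using int(2) by (intro lim_imp_Liminf tendsto_ennrealI) auto
  finally have *: "(\<integral>\<^sup>+x. ennreal ((g x)\<^sup>2) \<partial>M) \<le> ennreal L" .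
  then show i: "integrable M (\<lambda>x. (g x)\<^sup>2)"
    by (intro integrableI_bounded) (auto intro: le_less_trans)
  show "(\<integral>x. (g x)\<^sup>2 \<partial>M) \<le> L"
    using * L nn_integral_eq_integral[OF i] by (simp add: ennreal_le_iff)
qed

text \<open>Young's inequality. The weight \<open>d\<close> is later sent to \<open>0\<close>, so
  that the coefficient of \<open>x\<^sup>2\<close> tends to one.\<close>

lemma power2_add_le_weighted:
  fixes x y d :: real
  assumes "d > 0"
  shows "(x + y)\<^sup>2 \<le> (1 + d) * x\<^sup>2 + (1 + 1 / d) * y\<^sup>2"
proof -
  have "0 \<le> (d * x - y)\<^sup>2 / d" using assms by simp
  also have "\<dots> = d * x\<^sup>2 - 2 * x * y + y\<^sup>2 / d"
    using assms by (simp add: field_simps power2_eq_square)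
  finally show ?thesis by (simp add: power2_sum algebra_simps)
qed

context positive_density begin

text \<open>
  The difference quotients \<open>ratio_quotient a\<close> converge to the score in \<open>L\<^sup>2(P)\<close>: the distance between two of
  them is expressed by \<open>\<tau>\<close>, and Fatou's lemma transfers this to the limit.
\<close>

lemma mixed_derivative_le_fisher_information:
  assumes r: "r > 0"
    and fin: "\<And>a b. \<bar>a\<bar> < r \<Longrightarrow> \<bar>b\<bar> < r \<Longrightarrow> translation_finite P p (a, b)"
    and diag: "((\<lambda>b. \<tau> b b / b\<^sup>2) \<longlongrightarrow> c) (at 0)"
    and D: "\<And>a. \<bar>a\<bar> < r \<Longrightarrow> ((\<lambda>b. \<tau> a b) has_real_derivative D a) (at 0)"
    and D': "(D has_real_derivative c) (at 0)"
  shows "0 \<le> c" "c \<le> fisher_information p"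
proof -
  \<comment> \<open>A null sequence inside the open interval from \<open>0\<close> to
    \<open>r\<close>, since \<open>integral_square_limit_le\<close> works along sequences.\<close>
  define b where "b m = r / (real m + 2)" for m
  have b: "0 < b m" "b m < r" for m using r by (auto simp: b_def field_simps intro: add_pos_nonneg)
  have b0: "filterlim b (at 0) sequentially"
  proof -
    have "b \<longlonglongrightarrow> 0" unfolding b_def[abs_def] by real_asymp
    then show ?thesis using b by (simp add: filterlim_at less_imp_neq[symmetric])
  qed
  have bfin: "translation_finite P p (b m, b m)" for m using b[of m] by (intro fin) auto
  \<comment> \<open>The diagonal limit already forces \<open>\<tau> b b\<close> to tend to
    \<open>0\<close>, as \<open>exp_minus_one_quotient_tendsto\<close> requires.\<close>
  have "((\<lambda>b. \<tau> b b / b\<^sup>2 * b\<^sup>2) \<longlongrightarrow> c * 0\<^sup>2) (at 0)"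
    by (intro tendsto_intros diag)
  moreover have "\<forall>\<^sub>F b in at 0. \<tau> b b / b\<^sup>2 * b\<^sup>2 = \<tau> b b"
    unfolding eventually_at_filter by (intro always_eventually) simp
  ultimately have "((\<lambda>b. \<tau> b b) \<longlongrightarrow> c * 0\<^sup>2) (at 0)"
    by (rule Lim_transform_eventually)
  then have "((\<lambda>b. \<tau> b b) \<longlongrightarrow> 0) (at 0)" by (simp only: power_zero_numeral mult_zero_right)
  from exp_minus_one_quotient_tendsto[OF this diag]
  have diag': "((\<lambda>b. (exp (\<tau> b b) - 1) / b\<^sup>2) \<longlongrightarrow> c) (at 0)" .
  have K: "(\<lambda>m. (exp (\<tau> (b m) (b m)) - 1) / (b m)\<^sup>2) \<longlonglongrightarrow> c"
    using filterlim_compose[OF diag' b0] .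
  have K_int: "(\<lambda>m. \<integral>z. (ratio_quotient (b m) z)\<^sup>2 \<partial>P) \<longlonglongrightarrow> c"
    using K b bfin by (simp add: integral_ratio_quotient_sq less_imp_neq[symmetric])
  show c: "0 \<le> c" using K_int by (rule LIMSEQ_le_const) auto
  have b_int: "integrable P (\<lambda>z. (ratio_quotient (b m) z)\<^sup>2)" for m
    using bfin[of m] b(1)[of m] by (intro integrable_ratio_quotient_sq) auto
  have score: "integrable P (\<lambda>z. (score z)\<^sup>2)"
    by (rule integral_square_limit_le(1)[OF _ tendsto_ratio_quotient[OF b0] b_int K_int]) measurable
  \<comment> \<open>\<open>e a\<close> is the limit over \<open>m\<close> of the squared distance
    between \<open>ratio_quotient a\<close> and \<open>ratio_quotient (b m)\<close>; by Fatou it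
    bounds the squared distance to the score.\<close>
  define e where "e a = (exp (\<tau> a a) - 1) / a\<^sup>2 - 2 * D a / a + c" for a
  have diff: "integrable P (\<lambda>z. (ratio_quotient a z - score z)\<^sup>2)"
    "(\<integral>z. (ratio_quotient a z - score z)\<^sup>2 \<partial>P) \<le> e a" if a: "0 < a" "a < r" for a
  proof -
    have afin: "translation_finite P p (a, a)" "translation_finite P p (a, b m)" for m
      using a b[of m] by (auto intro!: fin)
    have "((\<lambda>b. exp (\<tau> a b)) has_real_derivative exp (\<tau> a 0) * D a) (at 0)"
      using a by (intro DERIV_fun_exp D) auto
    then have "((\<lambda>b. (exp (\<tau> a b) - 1) / b) \<longlongrightarrow> D a) (at 0)"
      by (simp add: DERIV_def)
    from filterlim_compose[OF this b0]
    have "(\<lambda>m. (exp (\<tau> a (b m)) - 1) / b m) \<longlonglongrightarrow> D a" .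
    with K have "(\<lambda>m. (exp (\<tau> a a) - 1) / a\<^sup>2 - 2 * ((exp (\<tau> a (b m)) - 1) / b m) / a
        + (exp (\<tau> (b m) (b m)) - 1) / (b m)\<^sup>2) \<longlonglongrightarrow> e a"
      unfolding e_def using a by (intro tendsto_intros) auto
    then have lim: "(\<lambda>m. \<integral>z. (ratio_quotient a z - ratio_quotient (b m) z)\<^sup>2 \<partial>P) \<longlonglongrightarrow> e a"
      using a b afin bfin by (simp add: integral_ratio_quotient_diff less_imp_neq[symmetric])
    have int: "integrable P (\<lambda>z. (ratio_quotient a z - ratio_quotient (b m) z)\<^sup>2)" for m
      using a b(1)[of m] afin bfin by (intro integrable_ratio_quotient_diff) auto
    have conv: "(\<lambda>m. ratio_quotient a z - ratio_quotient (b m) z) \<longlonglongrightarrow> ratio_quotient a z - score z" for z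
      by (intro tendsto_intros tendsto_ratio_quotient b0)
    show "integrable P (\<lambda>z. (ratio_quotient a z - score z)\<^sup>2)"
      by (rule integral_square_limit_le(1)[OF _ conv int lim]) measurable
    show "(\<integral>z. (ratio_quotient a z - score z)\<^sup>2 \<partial>P) \<le> e a"
      by (rule integral_square_limit_le(2)[OF _ conv int lim]) measurable
  qed
  \<comment> \<open>\<open>\<tau> 0\<close> vanishes identically, and therefore
    \<open>D a / a\<close> is a difference quotient of \<open>D\<close> at \<open>0\<close>.\<close>
  have "D 0 = 0"
    using D[of 0] r DERIV_unique[of "\<lambda>b. \<tau> 0 b" "D 0" 0 0] by simp
  then have "((\<lambda>a. D a / a) \<longlongrightarrow> c) (at 0)" using D' by (simp add: DERIV_def)
  from filterlim_compose[OF this b0] have "(\<lambda>m. D (b m) / b m) \<longlonglongrightarrow> c" .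
  with K have "(\<lambda>m. (exp (\<tau> (b m) (b m)) - 1) / (b m)\<^sup>2 - 2 * (D (b m) / b m) + c) \<longlonglongrightarrow> c - 2 * c + c"
    by (intro tendsto_intros)
  then have e0: "(\<lambda>m. e (b m)) \<longlonglongrightarrow> 0" by (simp add: e_def)
  \<comment> \<open>For fixed \<open>d\<close> the error term, despite its factor
    \<open>1 + 1 / d\<close>, vanishes as \<open>m\<close> grows; only afterwards does
    \<open>d\<close> tend to \<open>0\<close>.\<close>
  have weighted: "c \<le> (1 + d) * fisher_information p" if d: "d > 0" for d
  proof -
    have "(\<integral>z. (ratio_quotient (b m) z)\<^sup>2 \<partial>P)
        \<le> (1 + d) * fisher_information p + (1 + 1 / d) * e (b m)" for m
    proof -
      have "(\<integral>z. (ratio_quotient (b m) z)\<^sup>2 \<partial>P)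
          \<le> (\<integral>z. (1 + d) * (score z)\<^sup>2 + (1 + 1 / d) * (ratio_quotient (b m) z - score z)\<^sup>2 \<partial>P)"
        using b_int score diff(1)[OF b] power2_add_le_weighted[OF d, of "score z" "ratio_quotient (b m) z - score z" for z]
        by (intro integral_mono) auto
      also have "\<dots> = (1 + d) * fisher_information p
          + (1 + 1 / d) * (\<integral>z. (ratio_quotient (b m) z - score z)\<^sup>2 \<partial>P)"
        using score diff(1)[OF b] by (simp add: fisher_information_score)
      also have "\<dots> \<le> (1 + d) * fisher_information p + (1 + 1 / d) * e (b m)"
        using d by (intro add_left_mono mult_left_mono diff(2)[OF b]) auto
      finally show ?thesis .
    qed
    moreover have "(\<lambda>m. (1 + d) * fisher_information p + (1 + 1 / d) * e (b m))
        \<longlonglongrightarrow> (1 + d) * fisher_information p + (1 + 1 / d) * 0"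
      by (intro tendsto_intros e0)
    ultimately have "c \<le> (1 + d) * fisher_information p + (1 + 1 / d) * 0"
      by (intro LIMSEQ_le[OF K_int]) auto
    then show ?thesis by simp
  qed
  have "((\<lambda>d. (1 + d) * fisher_information p) \<longlongrightarrow> (1 + 0) * fisher_information p) (at_right 0)"
    by (intro tendsto_intros)
  moreover have "\<forall>\<^sub>F d in at_right 0. c \<le> (1 + d) * fisher_information p"
    using weighted by (auto simp: eventually_at_filter)
  ultimately have "c \<le> (1 + 0) * fisher_information p"
    by (rule tendsto_lowerbound) simp
  then show "c \<le> fisher_information p" by simp
qed

text \<open>\<open>\<tau>\<close> vanishes on both axes, which kills the constant term and the pure
  second derivatives. The two mixed ones coincide because \<open>\<tau>\<close> is symmetric in its
  arguments. Their common value is \<open>c\<close>, and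
  \<open>mixed_derivative_le_fisher_information\<close> compares it with the Fisher
  information.\<close>

lemma translation_function_bound:
  assumes U: "open U" "(0, 0) \<in> U" "\<And>ab. ab \<in> U \<Longrightarrow> translation_finite P p ab"
    and C4: "Ck_on 4 (translation_function P p) U"
    and sym: "distr P borel uminus = P"
  shows "\<exists>c C r. 0 \<le> c \<and> c \<le> fisher_information p \<and> 0 \<le> C \<and> r > 0 \<and>
    (\<forall>a b. \<bar>a\<bar> < r \<longrightarrow> \<bar>b\<bar> < r \<longrightarrow>
      translation_finite P p (a, b) \<and> \<tau> a b \<le> c * (a * b) + C * (a ^ 4 + b ^ 4))"
proof -
  let ?t = "translation_function P p"
  define D1 where "D1 = dir_deriv (1, 0) ?t"
  define D2 where "D2 = dir_deriv (0, 1) ?t"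
  define D11 where "D11 = dir_deriv (1, 0) D1 (0, 0)"
  define D22 where "D22 = dir_deriv (0, 1) D2 (0, 0)"
  define D12 where "D12 = dir_deriv (1, 0) D2 (0, 0)"
  define D21 where "D21 = dir_deriv (0, 1) D1 (0, 0)"
  obtain C r where C: "C \<ge> 0" and r: "r > 0" "{-r<..<r} \<times> {-r<..<r} \<subseteq> U"
    and bound: "\<And>a b. \<bar>a\<bar> < r \<Longrightarrow> \<bar>b\<bar> < r \<Longrightarrow>
      \<bar>\<tau> a b - \<tau> 0 0 - (a\<^sup>2 * D11 + a * b * (D12 + D21) + b\<^sup>2 * D22) / 2\<bar> \<le> C * (a ^ 4 + b ^ 4)"
    using even_taylor_Pair[OF U(1,2) C4] translation_function_even[OF sym]
    unfolding D1_def D2_def D11_def D22_def D12_def D21_def by metis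
  have inU: "(a, b) \<in> U" if "\<bar>a\<bar> < r" "\<bar>b\<bar> < r" for a b
    using r(2) that by (auto simp: abs_less_iff)
  \<comment> \<open>A multiple of \<open>a\<^sup>2\<close> that is \<open>O(a ^ 4)\<close> has
    coefficient zero: divide by \<open>a\<^sup>2\<close> and let \<open>a\<close> tend to
    \<open>0\<close>.\<close>
  have zero: "x = 0" if "\<And>a. 0 < a \<Longrightarrow> a < r \<Longrightarrow> \<bar>a\<^sup>2 * x / 2\<bar> \<le> C * a ^ 4" for x :: real
  proof -
    have "\<forall>\<^sub>F a in at_right 0. \<bar>x / 2\<bar> \<le> C * a\<^sup>2"
    proof (rule eventually_at_rightI[of 0 r])
      fix a assume a: "a \<in> {0<..<r}"
      then have "a\<^sup>2 * \<bar>x / 2\<bar> \<le> a\<^sup>2 * (C * a\<^sup>2)"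
        using that[of a] by (simp add: abs_mult power2_eq_square power4_eq_xxxx mult_ac)
      then show "\<bar>x / 2\<bar> \<le> C * a\<^sup>2" using a by simp
    qed (use r in auto)
    moreover have "((\<lambda>a. C * a\<^sup>2) \<longlongrightarrow> C * 0\<^sup>2) (at_right (0::real))"
      by (intro tendsto_intros)
    ultimately have "\<bar>x / 2\<bar> \<le> C * 0\<^sup>2"
      by (intro tendsto_lowerbound[of _ _ "at_right (0::real)"]) auto
    then show ?thesis by simp
  qed
  have D11: "D11 = 0" using bound[of _ 0] r by (intro zero) force
  have D22: "D22 = 0" using bound[of 0] r by (intro zero) force
  have d2: "((\<lambda>b. \<tau> a b) has_real_derivative D2 (a, 0)) (at 0)" if "\<bar>a\<bar> < r" for a
    using funpow_dir_deriv_on_line[of 0 ?t U "(a, 0)" 0 "(0, 1)"] Ck_on_le[OF _ C4, of 1] inU[OF that, of 0] r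
    by (simp add: D2_def del: Ck_on.simps)
  have d1: "((\<lambda>a. \<tau> a b) has_real_derivative D1 (0, b)) (at 0)" if "\<bar>b\<bar> < r" for b
    using funpow_dir_deriv_on_line[of 0 ?t U "(0, b)" 0 "(1, 0)"] Ck_on_le[OF _ C4, of 1] inU[OF _ that, of 0] r
    by (simp add: D1_def del: Ck_on.simps)
  have C1: "Ck_on 1 (dir_deriv v ?t) U" for v
    using Ck_on_le[OF _ C4, of "Suc 1"] by (simp only: Ck_on_Suc_dir_deriv)
  have d12: "((\<lambda>a. D2 (a, 0)) has_real_derivative D12) (at 0)"
    using funpow_dir_deriv_on_line[of 0 D2 U "(0, 0)" 0 "(1, 0)"] C1 U(2)
    by (simp add: D2_def D12_def del: Ck_on.simps)
  have d21: "((\<lambda>b. D1 (0, b)) has_real_derivative D21) (at 0)"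
    using funpow_dir_deriv_on_line[of 0 D1 U "(0, 0)" 0 "(0, 1)"] C1 U(2)
    by (simp add: D1_def D21_def del: Ck_on.simps)
  \<comment> \<open>Symmetry of \<open>\<tau>\<close> identifies the two partial derivatives along
    the axes, and with them the mixed derivatives at the origin.\<close>
  have swap: "D1 (0, b) = D2 (b, 0)" if "\<bar>b\<bar> < r" for b
    using d1[OF that] d2[OF that] DERIV_unique by (simp add: translation_function_commute[of _ b]) blast
  have "((\<lambda>a. D2 (a, 0)) has_real_derivative D21) (at 0)"
    using has_field_derivative_transform_within[OF d21 r(1)] swap by (auto simp: dist_real_def)
  then have D21: "D21 = D12" using d12 DERIV_unique by blast
  have bound': "\<bar>\<tau> a b - D12 * (a * b)\<bar> \<le> C * (a ^ 4 + b ^ 4)" if "\<bar>a\<bar> < r" "\<bar>b\<bar> < r" for a b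
    using bound[OF that] by (simp add: D11 D22 D21 mult_ac)
  have fin: "translation_finite P p (a, b)" if "\<bar>a\<bar> < r" "\<bar>b\<bar> < r" for a b
    using inU[OF that] U(3) by blast
  \<comment> \<open>On the diagonal the quadratic form is \<open>D12 * b\<^sup>2\<close>. This limit
    later yields the limit of the squared \<open>L\<^sup>2(P)\<close> norms of the difference
    quotients.\<close>
  have diag: "((\<lambda>b. \<tau> b b / b\<^sup>2) \<longlongrightarrow> D12) (at 0)"
  proof (rule LIM_zero_cancel, rule Lim_null_comparison)
    show "\<forall>\<^sub>F b in at 0. norm (\<tau> b b / b\<^sup>2 - D12) \<le> 2 * C * b\<^sup>2"
      unfolding eventually_at
    proof (intro exI[of _ r] conjI ballI impI r(1))
      fix b :: real assume b: "b \<noteq> 0 \<and> dist b 0 < r"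
      then have "\<bar>\<tau> b b - D12 * b\<^sup>2\<bar> / b\<^sup>2 \<le> C * (b ^ 4 + b ^ 4) / b\<^sup>2"
        using bound'[of b b] by (intro divide_right_mono) (auto simp: power2_eq_square)
      moreover have "\<bar>\<tau> b b - D12 * b\<^sup>2\<bar> / b\<^sup>2 = norm (\<tau> b b / b\<^sup>2 - D12)"
      proof -
        have "norm (\<tau> b b / b\<^sup>2 - D12) = \<bar>(\<tau> b b - D12 * b\<^sup>2) / b\<^sup>2\<bar>"
          using b by (simp add: diff_divide_distrib)
        then show ?thesis by (simp add: abs_divide)
      qed
      moreover have "C * (b ^ 4 + b ^ 4) / b\<^sup>2 = 2 * C * b\<^sup>2"
        using b by (simp add: power4_eq_xxxx power2_eq_square)
      ultimately show "norm (\<tau> b b / b\<^sup>2 - D12) \<le> 2 * C * b\<^sup>2" by simp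
    qed
    have "((\<lambda>b. 2 * C * b\<^sup>2) \<longlongrightarrow> 2 * C * 0\<^sup>2) (at (0::real))"
      by (intro tendsto_intros)
    then show "((\<lambda>b. 2 * C * b\<^sup>2) \<longlongrightarrow> 0) (at (0::real))" by simp
  qed
  show ?thesis
  proof (rule exI[of _ D12], rule exI[of _ C], rule exI[of _ r], intro conjI allI impI C r(1) fin)
    show "0 \<le> D12" "D12 \<le> fisher_information p"
      by (rule mixed_derivative_le_fisher_information[OF r(1) fin diag d2 d12]; assumption)+
    show "\<tau> a b \<le> D12 * (a * b) + C * (a ^ 4 + b ^ 4)" if "\<bar>a\<bar> < r" "\<bar>b\<bar> < r" for a b
      using bound'[OF that] by linarith
  qed
qed

end

subsection \<open>Likelihood ratios of translated noise\<close>

text \<open>Both sides agree on boxes, where the integral of a product of functions of separate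
  coordinates factorizes.\<close>

lemma density_PiM:
  assumes "finite I" "product_sigma_finite M" "product_sigma_finite (\<lambda>i. density (M i) (f i))"
    and f [measurable]: "\<And>i. f i \<in> borel_measurable (M i)"
  shows "density (PiM I M) (\<lambda>x. \<Prod>i\<in>I. f i (x i)) = PiM I (\<lambda>i. density (M i) (f i))"
proof -
  interpret M: product_sigma_finite M by fact
  interpret D: product_sigma_finite "\<lambda>i. density (M i) (f i)" by fact
  show ?thesis
  proof (rule D.PiM_eqI[OF \<open>finite I\<close>])
    show "sets (density (PiM I M) (\<lambda>x. \<Prod>i\<in>I. f i (x i))) = sets (PiM I (\<lambda>i. density (M i) (f i)))"
      by (simp cong: sets_PiM_cong)
  next
    fix A assume "\<And>i. i \<in> I \<Longrightarrow> A i \<in> sets (density (M i) (f i))"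
    then have A [measurable]: "\<And>i. i \<in> I \<Longrightarrow> A i \<in> sets (M i)" by simp
    have box: "Pi\<^sub>E I A \<in> sets (PiM I M)"
      using \<open>finite I\<close> A by (intro sets_PiM_I_finite)
    have "emeasure (density (PiM I M) (\<lambda>x. \<Prod>i\<in>I. f i (x i))) (Pi\<^sub>E I A)
        = (\<integral>\<^sup>+x. (\<Prod>i\<in>I. f i (x i)) * indicator (Pi\<^sub>E I A) x \<partial>PiM I M)"
      using box by (intro emeasure_density borel_measurable_prod_ennreal measurable_compose[OF _ f] measurable_component_singleton)
    also have "\<dots> = (\<integral>\<^sup>+x. (\<Prod>i\<in>I. f i (x i) * indicator (A i) (x i)) \<partial>PiM I M)"
    proof (rule nn_integral_cong)
      fix x assume "x \<in> space (PiM I M)"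
      then have ext: "x \<in> extensional I" by (simp add: space_PiM PiE_iff)
      have "indicator (Pi\<^sub>E I A) x = (\<Prod>i\<in>I. indicator (A i) (x i) :: ennreal)"
      proof (cases "\<forall>i\<in>I. x i \<in> A i")
        case True
        with ext show ?thesis by (simp add: PiE_iff)
      next
        case False
        then have "(\<Prod>i\<in>I. indicator (A i) (x i) :: ennreal) = 0"
          using \<open>finite I\<close> by (intro prod_zero) (auto simp: indicator_def)
        with False show ?thesis by (auto simp: PiE_iff)
      qed
      then show "(\<Prod>i\<in>I. f i (x i)) * indicator (Pi\<^sub>E I A) x = (\<Prod>i\<in>I. f i (x i) * indicator (A i) (x i))"
        by (simp add: prod.distrib)
    qed
    also have "\<dots> = (\<Prod>i\<in>I. \<integral>\<^sup>+z. f i z * indicator (A i) z \<partial>M i)"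
      using A by (intro M.product_nn_integral_prod \<open>finite I\<close>) measurable
    also have "\<dots> = (\<Prod>i\<in>I. emeasure (density (M i) (f i)) (A i))"
      using A by (intro prod.cong refl) (simp add: emeasure_density)
    finally show "emeasure (density (PiM I M) (\<lambda>x. \<Prod>i\<in>I. f i (x i))) (Pi\<^sub>E I A)
        = (\<Prod>i\<in>I. emeasure (density (M i) (f i)) (A i))" .
  qed
qed

text \<open>Plays the role of Cauchy-Schwarz: where \<open>m\<close> is at most \<open>1 / e\<close>
  the second term dominates, elsewhere \<open>e * m\<close> is at least one. Infinite
  \<open>m\<close> is covered.\<close>

lemma ennreal_mult_indicator_le:
  fixes m :: ennreal
  assumes "e > 0"
  shows "m * indicator A x \<le> ennreal e * (m * m) + ennreal (1 / e) * indicator A x"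
proof (cases "x \<in> A")
  case True
  show ?thesis
  proof (cases "m \<le> ennreal (1 / e)")
    case True
    with \<open>x \<in> A\<close> show ?thesis by (simp add: add_increasing)
  next
    case False
    then have "ennreal e * ennreal (1 / e) \<le> ennreal e * m"
      by (intro mult_left_mono) auto
    then have "1 \<le> ennreal e * m"
      using assms by (simp flip: ennreal_mult)
    then have "1 * m \<le> ennreal e * m * m" by (rule mult_right_mono) simp
    with \<open>x \<in> A\<close> show ?thesis by (simp add: add_increasing2 mult.assoc)
  qed
qed simp

section \<open>Sums over pairs of distinct indices\<close>

definition upper_pairs :: "nat \<Rightarrow> (nat \<times> nat) set" where
  "upper_pairs n = {(i, j). i < j \<and> j < n}"

lemma upper_pairs_0: "upper_pairs 0 = {}"
  and upper_pairs_Suc: "upper_pairs (Suc n) = upper_pairs n \<union> (\<lambda>i. (i, n)) ` {..<n}"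
  by (auto simp: upper_pairs_def less_Suc_eq)

lemma finite_upper_pairs [simp]: "finite (upper_pairs n)"
  by (induction n) (simp_all add: upper_pairs_0 upper_pairs_Suc)

lemma sum_upper_pairs:
  fixes y :: "nat \<Rightarrow> real"
  shows "2 * (\<Sum>(i, j)\<in>upper_pairs n. y i * y j) + (\<Sum>i<n. (y i)\<^sup>2) = (\<Sum>i<n. y i)\<^sup>2"
proof (induction n)
  case 0
  then show ?case by (simp add: upper_pairs_0)
next
  case (Suc n)
  have "(\<Sum>(i, j)\<in>upper_pairs (Suc n). y i * y j)
      = (\<Sum>(i, j)\<in>upper_pairs n. y i * y j) + (\<Sum>(i, j)\<in>(\<lambda>i. (i, n)) ` {..<n}. y i * y j)"
    unfolding upper_pairs_Suc by (rule sum.union_disjoint) (simp, simp, auto simp: upper_pairs_def)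
  also have "(\<Sum>(i, j)\<in>(\<lambda>i. (i, n)) ` {..<n}. y i * y j) = (\<Sum>i<n. y i) * y n"
    by (subst sum.reindex) (auto simp: inj_on_def sum_distrib_right)
  finally show ?case using Suc by (simp add: power2_sum algebra_simps)
qed

lemma sum_upper_pairs_le:
  fixes y :: "nat \<Rightarrow> real"
  shows "(\<Sum>(i, j)\<in>upper_pairs n. y i * y j) \<le> (\<Sum>i<n. y i)\<^sup>2 / 2"
  using sum_upper_pairs[of y n] sum_nonneg[of "{..<n}" "\<lambda>i. (y i)\<^sup>2"] by simp

context positive_density begin

definition noise :: "nat \<Rightarrow> (nat \<times> nat \<Rightarrow> real) measure" where
  "noise n = PiM (upper_pairs n) (\<lambda>_. P)"

text \<open>The likelihood ratio of the noise shifted by \<open>s\<close> against the unshifted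
  noise; see \<open>distr_noise_translation\<close>.\<close>

definition likelihood :: "nat \<Rightarrow> (nat \<times> nat \<Rightarrow> real) \<Rightarrow> (nat \<times> nat \<Rightarrow> real) \<Rightarrow> real" where
  "likelihood n s w = (\<Prod>k\<in>upper_pairs n. ratio (s k) (w k))"

lemma wigner_noise_eq: "wigner_noise n P = noise n"
  by (simp add: wigner_noise_def noise_def upper_pairs_def)

lemma prob_space_noise: "prob_space (noise n)"
  unfolding noise_def by (intro prob_space_PiM prob)

lemma sets_noise [simp, measurable_cong]: "sets (noise n) = sets (PiM (upper_pairs n) (\<lambda>_. borel))"
  unfolding noise_def by (intro sets_PiM_cong) auto

lemma space_noise: "space (noise n) = Pi\<^sub>E (upper_pairs n) (\<lambda>_. UNIV)"
  by (simp add: noise_def space_PiM)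

lemma ratio_measurable_pair [measurable]:
  assumes [measurable]: "f \<in> borel_measurable M" "g \<in> borel_measurable M"
  shows "(\<lambda>x. ratio (f x) (g x)) \<in> borel_measurable M"
  unfolding ratio_def by measurable

lemma distr_P_translation: "distr P borel (\<lambda>z. z + a) = density P (\<lambda>z. ennreal (ratio a z))"
proof (rule measure_eqI)
  fix A assume "A \<in> sets (distr P borel (\<lambda>z. z + a))"
  then have A [measurable]: "A \<in> sets borel" by simp
  have "emeasure (distr P borel (\<lambda>z. z + a)) A = (\<integral>\<^sup>+z. indicator A (z + a) \<partial>P)"
    by (simp add: nn_integral_distr flip: nn_integral_indicator)
  also have "\<dots> = (\<integral>\<^sup>+z. ennreal (p z) * indicator A (z + a) \<partial>lborel)"
    unfolding P_density by (rule nn_integral_density) auto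
  also have "\<dots> = (\<integral>\<^sup>+z. ennreal (p (z - a)) * indicator A z \<partial>lborel)"
    by (subst nn_integral_real_affine[of _ 1 "- a"]) auto
  also have "\<dots> = (\<integral>\<^sup>+z. ennreal (p z) * (ennreal (ratio a z) * indicator A z) \<partial>lborel)"
    by (intro nn_integral_cong) (simp add: ratio_def mult.assoc[symmetric] flip: ennreal_mult)
  also have "\<dots> = (\<integral>\<^sup>+z. ennreal (ratio a z) * indicator A z \<partial>P)"
    unfolding P_density by (rule nn_integral_density[symmetric]) auto
  finally show "emeasure (distr P borel (\<lambda>z. z + a)) A = emeasure (density P (\<lambda>z. ennreal (ratio a z))) A"
    by (simp add: emeasure_density)
qed simp

text \<open>The preimage of a box under a coordinatewise translation is a box. Hence the shifted law
  is the product of the shifted one-dimensional laws, and their densities multiply.\<close>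

lemma distr_noise_translation:
  "distr (noise n) (PiM (upper_pairs n) (\<lambda>_. borel)) (\<lambda>w. \<lambda>k\<in>upper_pairs n. w k + s k)
    = density (noise n) (\<lambda>w. ennreal (likelihood n s w))"
proof -
  let ?I = "upper_pairs n"
  let ?N = "\<lambda>k. distr P borel (\<lambda>z. z + s k)"
  have prob_N: "prob_space (?N k)" for k by (intro prob_space_distr) simp
  interpret N: product_prob_space ?N by (intro product_prob_spaceI prob_N)
  interpret P: product_prob_space "\<lambda>_. P" by (intro product_prob_spaceI prob)
  have "distr (noise n) (PiM ?I (\<lambda>_. borel)) (\<lambda>w. \<lambda>k\<in>?I. w k + s k) = PiM ?I ?N"
  proof (rule N.PiM_eqI)
    show "sets (distr (noise n) (PiM ?I (\<lambda>_. borel)) (\<lambda>w. \<lambda>k\<in>?I. w k + s k)) = sets (PiM ?I ?N)"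
      by (simp cong: sets_PiM_cong)
  next
    fix A assume "\<And>k. k \<in> ?I \<Longrightarrow> A k \<in> sets (?N k)"
    then have A [measurable]: "\<And>k. k \<in> ?I \<Longrightarrow> A k \<in> sets borel" by simp
    have A': "(\<lambda>z. z + s k) -` A k \<in> sets borel" if "k \<in> ?I" for k
      using measurable_sets[of "\<lambda>z. z + s k" borel borel "A k"] A[OF that] by simp
    have box: "Pi\<^sub>E ?I A \<in> sets (PiM ?I (\<lambda>_. borel))"
      by (intro sets_PiM_I_finite) auto
    have "emeasure (distr (noise n) (PiM ?I (\<lambda>_. borel)) (\<lambda>w. \<lambda>k\<in>?I. w k + s k)) (Pi\<^sub>E ?I A)
        = emeasure (noise n) ((\<lambda>w. \<lambda>k\<in>?I. w k + s k) -` Pi\<^sub>E ?I A \<inter> space (noise n))"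
      using box by (intro emeasure_distr) measurable
    also have "(\<lambda>w. \<lambda>k\<in>?I. w k + s k) -` Pi\<^sub>E ?I A \<inter> space (noise n) = Pi\<^sub>E ?I (\<lambda>k. (\<lambda>z. z + s k) -` A k)"
      by (auto simp: space_noise PiE_iff)
    also have "emeasure (noise n) \<dots> = (\<Prod>k\<in>?I. emeasure P ((\<lambda>z. z + s k) -` A k))"
      unfolding noise_def using A' by (intro P.emeasure_PiM) auto
    also have "\<dots> = (\<Prod>k\<in>?I. emeasure (?N k) (A k))"
      by (intro prod.cong refl) (simp add: emeasure_distr)
    finally show "emeasure (distr (noise n) (PiM ?I (\<lambda>_. borel)) (\<lambda>w. \<lambda>k\<in>?I. w k + s k)) (Pi\<^sub>E ?I A)
        = (\<Prod>k\<in>?I. emeasure (?N k) (A k))" .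
  qed simp
  also have "PiM ?I ?N = PiM ?I (\<lambda>k. density P (\<lambda>z. ennreal (ratio (s k) z)))"
    by (simp add: distr_P_translation)
  also have "\<dots> = density (noise n) (\<lambda>w. \<Prod>k\<in>?I. ennreal (ratio (s k) (w k)))"
    unfolding noise_def
    by (intro density_PiM[symmetric])
      (auto simp: distr_P_translation[symmetric] N.product_sigma_finite_axioms P.product_sigma_finite_axioms)
  finally show ?thesis by (simp add: likelihood_def prod_ennreal)
qed

text \<open>Independence turns the integral into a product over pairs, and by finiteness each factor
  is an exponential of \<open>\<tau>\<close>.\<close>

lemma likelihood_second_moment:
  assumes "\<And>k. k \<in> upper_pairs n \<Longrightarrow> translation_finite P p (s k, t k)"
  shows "(\<integral>\<^sup>+w. ennreal (likelihood n s w) * ennreal (likelihood n t w) \<partial>noise n)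
    = ennreal (exp (\<Sum>k\<in>upper_pairs n. \<tau> (s k) (t k)))"
proof -
  interpret P: product_prob_space "\<lambda>_. P" by (intro product_prob_spaceI prob)
  have "(\<integral>\<^sup>+w. ennreal (likelihood n s w) * ennreal (likelihood n t w) \<partial>noise n)
      = (\<integral>\<^sup>+w. (\<Prod>k\<in>upper_pairs n. ennreal (ratio (s k) (w k) * ratio (t k) (w k))) \<partial>noise n)"
    by (simp add: likelihood_def prod_ennreal prod.distrib ennreal_mult prod_nonneg)
  also have "\<dots> = (\<Prod>k\<in>upper_pairs n. \<integral>\<^sup>+z. ennreal (ratio (s k) z * ratio (t k) z) \<partial>P)"
    unfolding noise_def by (intro P.product_nn_integral_prod) auto
  also have "\<dots> = (\<Prod>k\<in>upper_pairs n. ennreal (exp (\<tau> (s k) (t k))))"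
    using assms by (intro prod.cong refl, subst nn_integral_eq_integral)
      (auto simp: translation_finite_ratio exp_translation_function)
  finally show ?thesis by (simp add: prod_ennreal exp_sum)
qed

end

subsection \<open>Truncated second moment bound\<close>

text \<open>The spike in units of the noise: its entries are multiplied by \<open>sqrt n\<close>,
  the inverse of the noise scale.\<close>

definition spike_shift :: "nat \<Rightarrow> real \<Rightarrow> (nat \<Rightarrow> real) \<Rightarrow> nat \<times> nat \<Rightarrow> real" where
  "spike_shift n l x = (\<lambda>(i, j). l * sqrt n * (x i * x j))"

lemma spiked_matrix_measurable:
  "(\<lambda>(x, w). spiked_matrix n l x w)
    \<in> vec_space n \<Otimes>\<^sub>M PiM (upper_pairs n) (\<lambda>_. borel) \<rightarrow>\<^sub>M mat_space n"
  unfolding spiked_matrix_def split_beta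
proof (rule measurable_restrict)
  fix k assume "k \<in> {..<n} \<times> {..<n}"
  then obtain i j where k: "k = (i, j)" "i < n" "j < n" by auto
  show "(\<lambda>z. if fst k = snd k then 0 else l * fst z (fst k) * fst z (snd k)
        + 1 / sqrt n * snd z (min (fst k) (snd k), max (fst k) (snd k)))
      \<in> borel_measurable (vec_space n \<Otimes>\<^sub>M PiM (upper_pairs n) (\<lambda>_. borel))"
  proof (cases "i = j")
    case False
    then have "(min i j, max i j) \<in> upper_pairs n" using k by (auto simp: upper_pairs_def)
    then have [measurable]: "(\<lambda>z. snd z (min i j, max i j)) \<in> borel_measurable (vec_space n \<Otimes>\<^sub>M PiM (upper_pairs n) (\<lambda>_. borel))"
      by (intro measurable_compose[OF measurable_snd] measurable_component_singleton)
    have [measurable]: "(\<lambda>z. fst z i) \<in> borel_measurable (vec_space n \<Otimes>\<^sub>M PiM (upper_pairs n) (\<lambda>_. borel))"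
      "(\<lambda>z. fst z j) \<in> borel_measurable (vec_space n \<Otimes>\<^sub>M PiM (upper_pairs n) (\<lambda>_. borel))"
      using k by (auto intro!: measurable_compose[OF measurable_fst] measurable_component_singleton)
    show ?thesis using False k(1) by simp
  qed (simp add: k(1))
qed

text \<open>The spike is absorbed into the noise, so that only the law of the noise changes. The
  vector \<open>y\<close> is arbitrary because its coefficient is zero. Off the diagonal the pair of
  minimum and maximum lies in \<open>upper_pairs n\<close>, where the restricted function has its
  proper value.\<close>

lemma spiked_matrix_spike_shift:
  assumes "n > 0"
  shows "spiked_matrix n l x w = spiked_matrix n 0 y (\<lambda>k\<in>upper_pairs n. w k + spike_shift n l x k)"
proof
  fix k :: "nat \<times> nat"
  obtain i j where k: "k = (i, j)" by (cases k)
  have "x (min i j) * x (max i j) = x i * x j" by (auto simp: min_def max_def)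
  moreover have "(min i j, max i j) \<in> upper_pairs n" if "i < n" "j < n" "i \<noteq> j"
    using that by (auto simp: upper_pairs_def)
  ultimately show "spiked_matrix n l x w k
      = spiked_matrix n 0 y (\<lambda>k\<in>upper_pairs n. w k + spike_shift n l x k) k"
    using assms by (auto simp: spiked_matrix_def spike_shift_def k restrict_def field_simps)
qed

lemma spiked_matrix_0: "spiked_matrix n 0 x w = spiked_matrix n 0 y w"
  by (simp add: spiked_matrix_def fun_eq_iff restrict_def)

context positive_density begin

context
  fixes X :: "nat \<Rightarrow> (nat \<Rightarrow> real) measure" and n :: nat
  assumes prob_X: "prob_space (X n)" and sets_X [measurable_cong]: "sets (X n) = sets (vec_space n)"
begin

lemma spiked_matrix_measurable_X [measurable]:
  "(\<lambda>z. spiked_matrix n l (fst z) (snd z)) \<in> X n \<Otimes>\<^sub>M noise n \<rightarrow>\<^sub>M mat_space n"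
  using spiked_matrix_measurable[of n l]
  by (simp add: split_beta measurable_cong_sets[OF sets_pair_measure_cong[OF sets_X sets_noise] refl])

lemma spike_shift_measurable [measurable]:
  assumes k: "k \<in> upper_pairs n" and [measurable]: "f \<in> M \<rightarrow>\<^sub>M X n"
  shows "(\<lambda>z. spike_shift n l (f z) k) \<in> borel_measurable M"
proof -
  obtain i j where k': "k = (i, j)" "i < n" "j < n" using k by (auto simp: upper_pairs_def)
  have f: "f \<in> M \<rightarrow>\<^sub>M vec_space n"
    using assms(2) by (simp only: measurable_cong_sets[OF refl sets_X])
  have [measurable]: "(\<lambda>z. f z i) \<in> borel_measurable M" "(\<lambda>z. f z j) \<in> borel_measurable M"
    using k' by (auto intro!: measurable_compose[OF f] measurable_component_singleton)
  show ?thesis by (simp add: spike_shift_def k'(1))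
qed

lemma likelihood_measurable [measurable]:
  assumes [measurable]: "f \<in> M \<rightarrow>\<^sub>M X n" "g \<in> M \<rightarrow>\<^sub>M noise n"
  shows "(\<lambda>z. likelihood n (spike_shift n l (f z)) (g z)) \<in> borel_measurable M"
  unfolding likelihood_def
proof (rule borel_measurable_prod)
  fix k assume k: "k \<in> upper_pairs n"
  have g: "g \<in> M \<rightarrow>\<^sub>M PiM (upper_pairs n) (\<lambda>_. borel)"
    using assms(2) by (simp only: measurable_cong_sets[OF refl sets_noise])
  have [measurable]: "(\<lambda>z. g z k) \<in> borel_measurable M"
    using k by (auto intro!: measurable_compose[OF g] measurable_component_singleton)
  show "(\<lambda>z. ratio (spike_shift n l (f z) k) (g z k)) \<in> borel_measurable M"
    using k by measurable
qed

lemma emeasure_Wig: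
  assumes [measurable]: "A \<in> sets (mat_space n)"
  shows "emeasure (Wig n l P X) A = (\<integral>\<^sup>+x. \<integral>\<^sup>+w. indicator A (spiked_matrix n l x w) \<partial>noise n \<partial>X n)"
proof -
  interpret noise: prob_space "noise n" by (rule prob_space_noise)
  have "emeasure (Wig n l P X) A = (\<integral>\<^sup>+y. indicator A y \<partial>Wig n l P X)"
    by (simp add: Wig_def)
  also have "\<dots> = (\<integral>\<^sup>+z. indicator A (spiked_matrix n l (fst z) (snd z)) \<partial>(X n \<Otimes>\<^sub>M noise n))"
    unfolding Wig_def wigner_noise_eq split_beta by (subst nn_integral_distr) auto
  also have "\<dots> = (\<integral>\<^sup>+x. \<integral>\<^sup>+w. indicator A (spiked_matrix n l x w) \<partial>noise n \<partial>X n)"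
    by (subst noise.nn_integral_fst[symmetric]) auto
  finally show ?thesis .
qed

text \<open>For a spike outside \<open>G\<close> the probability of \<open>A\<close> is bounded by
  one. The part over \<open>G\<close> is the integral, over an event, of the averaged likelihood
  ratio \<open>m\<close>. \<open>ennreal_mult_indicator_le\<close> trades it for the second moment
  of \<open>m\<close>, a double integral over two independent spikes.\<close>

lemma emeasure_Wig_le:
  assumes n: "n > 0" and A [measurable]: "A \<in> sets (mat_space n)"
    and G [measurable]: "G \<in> sets (X n)" and e: "e > 0"
    and second_moment: "(\<integral>\<^sup>+x. \<integral>\<^sup>+x'. indicator G x * indicator G x' *
        (\<integral>\<^sup>+w. ennreal (likelihood n (spike_shift n l x) w) * ennreal (likelihood n (spike_shift n l x') w) \<partial>noise n)
        \<partial>X n \<partial>X n) \<le> S"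
  shows "emeasure (Wig n l P X) A
    \<le> emeasure (X n) (space (X n) - G) + (ennreal e * S + ennreal (1 / e) * emeasure (Wig n 0 P X) A)"
proof -
  interpret noise: prob_space "noise n" by (rule prob_space_noise)
  interpret X: prob_space "X n" by (rule prob_X)
  interpret pair_sigma_finite "X n" "noise n" ..
  define L where "L x w = ennreal (likelihood n (spike_shift n l x) w)" for x w
  \<comment> \<open>The event \<open>A\<close> as seen by the noise in the null model. The zero
    vector is a placeholder spike, restricted to \<open>{..<n}\<close> so that it belongs to
    \<open>space (X n)\<close>.\<close>
  define B where "B = {w \<in> space (noise n). spiked_matrix n 0 (\<lambda>i\<in>{..<n}. 0) w \<in> A}"
  have zero: "(\<lambda>i\<in>{..<n}. 0) \<in> space (X n)"
    using sets_eq_imp_space_eq[OF sets_X] by (simp add: space_PiM)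
  have [measurable]: "spiked_matrix n 0 (\<lambda>i\<in>{..<n}. 0) \<in> noise n \<rightarrow>\<^sub>M mat_space n"
    using measurable_compose[OF measurable_Pair1'[OF zero] spiked_matrix_measurable_X[of 0]] by simp
  have B [measurable]: "B \<in> sets (noise n)" unfolding B_def by measurable
  have [measurable]: "(\<lambda>z. L (fst z) (snd z)) \<in> borel_measurable (X n \<Otimes>\<^sub>M noise n)"
    unfolding L_def by measurable
  have [measurable]: "L x \<in> borel_measurable (noise n)" if "x \<in> space (X n)" for x
    using measurable_compose[OF measurable_Pair1'[OF that], of "\<lambda>z. L (fst z) (snd z)" "noise n" borel] by simp
  have shift: "(\<integral>\<^sup>+w. indicator A (spiked_matrix n l x w) \<partial>noise n) = (\<integral>\<^sup>+w. L x w * indicator B w \<partial>noise n)"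
    if x: "x \<in> space (X n)" for x
  proof -
    let ?T = "\<lambda>w. \<lambda>k\<in>upper_pairs n. w k + spike_shift n l x k"
    have T: "?T \<in> noise n \<rightarrow>\<^sub>M PiM (upper_pairs n) (\<lambda>_. borel)"
      by measurable
    have "(\<integral>\<^sup>+w. indicator A (spiked_matrix n l x w) \<partial>noise n) = (\<integral>\<^sup>+w. indicator B (?T w) \<partial>noise n)"
      using n by (intro nn_integral_cong)
        (auto simp: B_def indicator_def space_noise spiked_matrix_spike_shift[of n l x _ "\<lambda>i\<in>{..<n}. 0"])
    also have "\<dots> = (\<integral>\<^sup>+u. indicator B u \<partial>distr (noise n) (PiM (upper_pairs n) (\<lambda>_. borel)) ?T)"
      using B by (subst nn_integral_distr[OF T]) auto
    also have "\<dots> = (\<integral>\<^sup>+w. L x w * indicator B w \<partial>noise n)"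
      unfolding distr_noise_translation using x B unfolding L_def
      by (subst nn_integral_density) (auto simp: L_def[symmetric])
    finally show ?thesis .
  qed
  have Wig_l: "emeasure (Wig n l P X) A = (\<integral>\<^sup>+x. \<integral>\<^sup>+w. L x w * indicator B w \<partial>noise n \<partial>X n)"
    unfolding emeasure_Wig[OF A] by (intro nn_integral_cong shift)
  have "indicator A (spiked_matrix n 0 x w) = (indicator B w :: ennreal)" if "w \<in> space (noise n)" for x w
    using that spiked_matrix_0[of n x w "\<lambda>i\<in>{..<n}. 0"] by (simp add: B_def indicator_def)
  then have Wig_0: "emeasure (Wig n 0 P X) A = emeasure (noise n) B"
    unfolding emeasure_Wig[OF A]
    by (simp add: X.emeasure_space_1 nn_integral_indicator[OF B] cong: nn_integral_cong)
  have le1: "(\<integral>\<^sup>+w. L x w * indicator B w \<partial>noise n) \<le> 1" if "x \<in> space (X n)" for x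
  proof -
    have "(\<integral>\<^sup>+w. indicator A (spiked_matrix n l x w) \<partial>noise n) \<le> (\<integral>\<^sup>+w. 1 \<partial>noise n)"
      by (intro nn_integral_mono) (simp add: indicator_def)
    then show ?thesis by (simp add: shift[OF that] noise.emeasure_space_1)
  qed
  \<comment> \<open>Truncation without renormalization: spikes outside \<open>G\<close> contribute
    nothing to the average \<open>m\<close>.\<close>
  define h where "h x w = indicator G x * L x w" for x w
  have h [measurable]: "(\<lambda>z. h (fst z) (snd z)) \<in> borel_measurable (X n \<Otimes>\<^sub>M noise n)"
    unfolding h_def by measurable
  have [measurable]: "h x \<in> borel_measurable (noise n)" if "x \<in> space (X n)" for x
    using measurable_compose[OF measurable_Pair1'[OF that] h] by simp
  have h_fst [measurable]: "(\<lambda>x. h x w) \<in> borel_measurable (X n)" if "w \<in> space (noise n)" for w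
    using measurable_compose[OF measurable_Pair2'[OF that] h] by simp
  define m where "m w = (\<integral>\<^sup>+x. h x w \<partial>X n)" for w
  have m [measurable]: "m \<in> borel_measurable (noise n)"
  proof -
    \<comment> \<open>The factors are swapped so that the variable integrated out comes second, as
      the measurability rule for parametrized integrals expects.\<close>
    have [measurable]: "(\<lambda>z. h (snd z) (fst z)) \<in> borel_measurable (noise n \<Otimes>\<^sub>M X n)"
      unfolding h_def L_def by measurable
    show ?thesis unfolding m_def by measurable
  qed
  have "emeasure (Wig n l P X) A
      \<le> (\<integral>\<^sup>+x. indicator (space (X n) - G) x + (\<integral>\<^sup>+w. h x w * indicator B w \<partial>noise n) \<partial>X n)"
    unfolding Wig_l
  proof (rule nn_integral_mono)
    fix x assume "x \<in> space (X n)"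
    then show "(\<integral>\<^sup>+w. L x w * indicator B w \<partial>noise n)
        \<le> indicator (space (X n) - G) x + (\<integral>\<^sup>+w. h x w * indicator B w \<partial>noise n)"
      using le1[of x] by (cases "x \<in> G") (auto simp: h_def)
  qed
  also have "\<dots> = emeasure (X n) (space (X n) - G) + (\<integral>\<^sup>+x. \<integral>\<^sup>+w. h x w * indicator B w \<partial>noise n \<partial>X n)"
    by (subst nn_integral_add) auto
  also have "(\<integral>\<^sup>+x. \<integral>\<^sup>+w. h x w * indicator B w \<partial>noise n \<partial>X n)
      = (\<integral>\<^sup>+w. \<integral>\<^sup>+x. h x w * indicator B w \<partial>X n \<partial>noise n)"
    by (rule Fubini'[symmetric]) (simp add: split_beta)
  also have "\<dots> = (\<integral>\<^sup>+w. m w * indicator B w \<partial>noise n)"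
    unfolding m_def by (intro nn_integral_cong nn_integral_multc h_fst)
  also have "\<dots> \<le> (\<integral>\<^sup>+w. ennreal e * (m w * m w) + ennreal (1 / e) * indicator B w \<partial>noise n)"
    by (intro nn_integral_mono ennreal_mult_indicator_le e)
  also have "\<dots> = ennreal e * (\<integral>\<^sup>+w. m w * m w \<partial>noise n) + ennreal (1 / e) * emeasure (Wig n 0 P X) A"
    by (subst nn_integral_add) (auto simp: nn_integral_cmult Wig_0 nn_integral_indicator[OF B])
  \<comment> \<open>The square of an average becomes an average over two copies \<open>x\<close> and
    \<open>x'\<close>; the two factors \<open>m w\<close> are unfolded one after the other, each
    time exchanging the order of integration.\<close>
  also have "(\<integral>\<^sup>+w. m w * m w \<partial>noise n) = (\<integral>\<^sup>+w. \<integral>\<^sup>+x. h x w * m w \<partial>X n \<partial>noise n)"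
    by (intro nn_integral_cong) (subst nn_integral_multc[OF h_fst], simp_all add: m_def)
  also have "\<dots> = (\<integral>\<^sup>+x. \<integral>\<^sup>+w. h x w * m w \<partial>noise n \<partial>X n)"
    by (rule Fubini') (simp add: split_beta)
  also have "\<dots> = (\<integral>\<^sup>+x. \<integral>\<^sup>+w. \<integral>\<^sup>+x'. h x w * h x' w \<partial>X n \<partial>noise n \<partial>X n)"
    unfolding m_def by (intro nn_integral_cong nn_integral_cmult[symmetric] h_fst)
  also have "\<dots> = (\<integral>\<^sup>+x. \<integral>\<^sup>+x'. \<integral>\<^sup>+w. h x w * h x' w \<partial>noise n \<partial>X n \<partial>X n)"
    by (intro nn_integral_cong Fubini') measurable
  also have "\<dots> = (\<integral>\<^sup>+x. \<integral>\<^sup>+x'. indicator G x * indicator G x' * (\<integral>\<^sup>+w. L x w * L x' w \<partial>noise n) \<partial>X n \<partial>X n)"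
    by (intro nn_integral_cong, subst nn_integral_cmult[symmetric]) (auto simp: h_def mult_ac)
  also have "\<dots> \<le> S" using second_moment by (simp add: L_def)
  finally show ?thesis by (simp add: add_left_mono add_right_mono mult_left_mono)
qed

end

text \<open>Since \<open>c\<close> is nonnegative, the bilinear terms are at most half of the
  completed square, which is the inner product squared. The quartic terms stay bounded: the factor
  \<open>n\<^sup>2\<close> in the fourth power of a shift cancels against the square of
  \<open>a / n\<close>.\<close>

lemma sum_translation_function_le:
  assumes bound: "\<And>a b. \<bar>a\<bar> < r \<Longrightarrow> \<bar>b\<bar> < r \<Longrightarrow> \<tau> a b \<le> c * (a * b) + C * (a ^ 4 + b ^ 4)"
    and c: "0 \<le> c" and C: "0 \<le> C" and n: "n > 0"
    and small: "\<And>k. k \<in> upper_pairs n \<Longrightarrow> \<bar>spike_shift n l x k\<bar> < r"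
      "\<And>k. k \<in> upper_pairs n \<Longrightarrow> \<bar>spike_shift n l x' k\<bar> < r"
    and x: "(\<Sum>i<n. x i ^ 4) \<le> a / n" and x': "(\<Sum>i<n. x' i ^ 4) \<le> a / n"
  shows "(\<Sum>k\<in>upper_pairs n. \<tau> (spike_shift n l x k) (spike_shift n l x' k))
    \<le> c * l\<^sup>2 * n / 2 * (\<Sum>i<n. x i * x' i)\<^sup>2 + C * l ^ 4 * a\<^sup>2"
proof -
  have quartic: "(\<Sum>k\<in>upper_pairs n. (spike_shift n l y k) ^ 4) \<le> l ^ 4 * a\<^sup>2 / 2"
    if y: "(\<Sum>i<n. y i ^ 4) \<le> a / n" for y
  proof -
    have "(spike_shift n l y k) ^ 4 = l ^ 4 * (real n)\<^sup>2 * (case k of (i, j) \<Rightarrow> y i ^ 4 * y j ^ 4)" for k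
    proof -
      have "sqrt n ^ 4 = (real n)\<^sup>2" by (simp add: power4_eq_xxxx power2_eq_square)
      then show ?thesis by (simp add: spike_shift_def split_beta power_mult_distrib)
    qed
    then have "(\<Sum>k\<in>upper_pairs n. (spike_shift n l y k) ^ 4)
        = l ^ 4 * (real n)\<^sup>2 * (\<Sum>(i, j)\<in>upper_pairs n. y i ^ 4 * y j ^ 4)"
      by (simp add: sum_distrib_left)
    also have "\<dots> \<le> l ^ 4 * (real n)\<^sup>2 * ((\<Sum>i<n. y i ^ 4)\<^sup>2 / 2)"
      by (intro mult_left_mono sum_upper_pairs_le) auto
    also have "\<dots> \<le> l ^ 4 * (real n)\<^sup>2 * ((a / n)\<^sup>2 / 2)"
      using y by (intro mult_left_mono divide_right_mono power_mono sum_nonneg) auto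
    also have "\<dots> = l ^ 4 * a\<^sup>2 / 2" using n by (simp add: power_divide)
    finally show ?thesis .
  qed
  have prod: "spike_shift n l x k * spike_shift n l x' k
      = l\<^sup>2 * n * (case k of (i, j) \<Rightarrow> (x i * x' i) * (x j * x' j))" for k
  proof -
    have "l * sqrt n * (x i * x j) * (l * sqrt n * (x' i * x' j))
        = (l * l) * (sqrt n * sqrt n) * ((x i * x' i) * (x j * x' j))" for i j
      by (simp only: mult_ac)
    then show ?thesis by (simp add: spike_shift_def split_beta power2_eq_square)
  qed
  have "(\<Sum>k\<in>upper_pairs n. \<tau> (spike_shift n l x k) (spike_shift n l x' k))
      \<le> (\<Sum>k\<in>upper_pairs n. c * (spike_shift n l x k * spike_shift n l x' k)
        + C * (spike_shift n l x k ^ 4 + spike_shift n l x' k ^ 4))"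
    by (intro sum_mono bound small)
  also have "\<dots> = c * (l\<^sup>2 * n * (\<Sum>(i, j)\<in>upper_pairs n. (x i * x' i) * (x j * x' j)))
      + C * ((\<Sum>k\<in>upper_pairs n. spike_shift n l x k ^ 4) + (\<Sum>k\<in>upper_pairs n. spike_shift n l x' k ^ 4))"
    by (simp add: prod sum.distrib sum_distrib_left distrib_left)
  also have "\<dots> \<le> c * (l\<^sup>2 * n * ((\<Sum>i<n. x i * x' i)\<^sup>2 / 2)) + C * (l ^ 4 * a\<^sup>2 / 2 + l ^ 4 * a\<^sup>2 / 2)"
    using c C sum_upper_pairs_le[of "\<lambda>i. x i * x' i" n]
    by (intro add_mono mult_left_mono quartic x x') auto
  finally show ?thesis by (simp add: mult_ac)
qed

end

subsection \<open>Contiguity\<close>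

text \<open>The exponent is \<open>- 1 / 4\<close>, so the fourth power of the norm decays like
  \<open>1 / n\<close>.\<close>

lemma sum_pow4_le_of_lq_norm:
  assumes "n > 0" "lq_norm 4 n x \<le> \<alpha> * real n powr (1 / 4 - 1 / 2)"
  shows "(\<Sum>i<n. x i ^ 4) \<le> \<alpha> ^ 4 / n"
proof -
  have "(\<Sum>i<n. x i ^ 4) = (\<Sum>i<n. \<bar>x i\<bar> ^ 4)" by simp
  also have "\<dots> = lq_norm 4 n x ^ 4"
    by (simp add: lq_norm_def real_root_pow_pos2 sum_nonneg)
  also have "\<dots> \<le> (\<alpha> * real n powr (1 / 4 - 1 / 2)) ^ 4"
    using assms(2) by (intro power_mono) (auto simp: lq_norm_def sum_nonneg)
  also have "(real n powr (1 / 4 - 1 / 2)) ^ 4 = real n powr (- 1)"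
    using assms(1) by (subst powr_power) auto
  then have "(\<alpha> * real n powr (1 / 4 - 1 / 2)) ^ 4 = \<alpha> ^ 4 / n"
    using assms(1) by (simp only: power_mult_distrib) (simp add: powr_minus_divide)
  finally show ?thesis .
qed

text \<open>For positive \<open>F\<close> the number \<open>l * sqrt F\<close> lies strictly below a
  supremum, so some admissible \<open>l'\<close> exceeds it. For \<open>F = 0\<close> the choice
  \<open>l' = 0\<close>, whose second moment is one, serves.\<close>

lemma gaussian_threshold_witness:
  assumes "0 \<le> l" "0 \<le> F" "ereal l < gaussian_threshold X / ereal (sqrt F)"
    and "\<And>n. prob_space (X n)"
  obtains l' C where "F * l\<^sup>2 \<le> l'\<^sup>2" "\<forall>\<^sub>F n in sequentially. gaussian_second_moment X l' n \<le> ennreal C"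
proof (cases "F = 0")
  case True
  have "gaussian_second_moment X 0 n \<le> ennreal 1" for n
  proof -
    interpret prob_space "X n" by fact
    interpret XX: pair_prob_space "X n" "X n" ..
    have "gaussian_second_moment X 0 n = (\<integral>\<^sup>+z. 1 \<partial>(X n \<Otimes>\<^sub>M X n))"
      unfolding gaussian_second_moment_def by (intro nn_integral_cong) auto
    then show ?thesis by (simp add: XX.emeasure_space_1)
  qed
  then show ?thesis using True by (intro that[of 0 1]) auto
next
  case False
  then have F: "F > 0" using assms(2) by simp
  then have "ereal (l * sqrt F) < gaussian_threshold X"
    using assms(3) ereal_less_divide_pos[of "ereal (sqrt F)" "ereal l" "gaussian_threshold X"]
    by (simp add: mult.commute)
  then obtain l' C where l': "l * sqrt F < l'" "\<forall>\<^sub>F n in sequentially. gaussian_second_moment X l' n \<le> ennreal C"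
    unfolding gaussian_threshold_def less_SUP_iff by auto
  have "(l * sqrt F)\<^sup>2 \<le> l'\<^sup>2" using l'(1) assms F by (intro power_mono) auto
  then show ?thesis using that l'(2) F by (simp add: power_mult_distrib mult.commute)
qed

text \<open>First \<open>e\<close> is fixed so that \<open>e * S\<close> is small. Then
  \<open>n\<close> grows, and both \<open>d n\<close> and the probability under \<open>Q n\<close>,
  with its constant factor \<open>1 / e\<close>, vanish.\<close>

lemma contiguousI_second_moment:
  fixes P Q :: "nat \<Rightarrow> 'a measure"
  assumes fin: "\<And>n. prob_space (P n)" "\<And>n. prob_space (Q n)"
    and d: "d \<longlonglongrightarrow> 0"
    and le: "\<And>e A. e > 0 \<Longrightarrow> (\<And>n. A n \<in> sets (Q n)) \<Longrightarrow> \<forall>\<^sub>F n in sequentially.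
      emeasure (P n) (A n) \<le> ennreal (d n) + (ennreal e * ennreal S + ennreal (1 / e) * emeasure (Q n) (A n))"
    and S: "S \<ge> 0"
  shows "contiguous P Q"
  unfolding contiguous_def
proof (intro allI impI)
  fix A assume A: "\<forall>n. A n \<in> sets (Q n)" and Q: "(\<lambda>n. measure (Q n) (A n)) \<longlonglongrightarrow> 0"
  show "(\<lambda>n. measure (P n) (A n)) \<longlonglongrightarrow> 0"
  proof (rule order_tendstoI)
    fix a :: real assume "a < 0"
    then show "\<forall>\<^sub>F n in sequentially. a < measure (P n) (A n)"
      by (intro always_eventually allI less_le_trans[OF _ measure_nonneg])
  next
    fix a :: real assume a: "0 < a"
    \<comment> \<open>Makes \<open>e * S\<close> at most \<open>a / 2\<close>; the
      \<open>+ 1\<close> avoids a division by zero when \<open>S = 0\<close>.\<close>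
    define e where "e = a / (2 * (S + 1))"
    have e: "e > 0" using a S by (simp add: e_def)
    have "e * S < a"
    proof -
      have "e * S \<le> e * (S + 1)" using e by simp
      also have "\<dots> = a / 2" using S by (simp add: e_def field_simps)
      finally show ?thesis using a by simp
    qed
    \<comment> \<open>The absolute value appears because \<open>d n\<close> is not assumed
      nonnegative, whereas \<open>ennreal\<close> sends negative reals to \<open>0\<close>.\<close>
    moreover have "(\<lambda>n. \<bar>d n\<bar> + (e * S + 1 / e * measure (Q n) (A n))) \<longlonglongrightarrow> \<bar>0\<bar> + (e * S + 1 / e * 0)"
      by (intro tendsto_intros d Q)
    ultimately have "\<forall>\<^sub>F n in sequentially. \<bar>d n\<bar> + (e * S + 1 / e * measure (Q n) (A n)) < a"
      by (intro order_tendstoD(2)) auto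
    moreover have "\<forall>\<^sub>F n in sequentially. emeasure (P n) (A n)
        \<le> ennreal (d n) + (ennreal e * ennreal S + ennreal (1 / e) * emeasure (Q n) (A n))"
      using A by (intro le e) auto
    ultimately show "\<forall>\<^sub>F n in sequentially. measure (P n) (A n) < a"
    proof eventually_elim
      case (elim n)
      interpret P: prob_space "P n" by (rule fin)
      interpret Q: prob_space "Q n" by (rule fin)
      have "ennreal (measure (P n) (A n))
          \<le> ennreal \<bar>d n\<bar> + (ennreal e * ennreal S + ennreal (1 / e) * ennreal (measure (Q n) (A n)))"
        using elim(2) unfolding P.emeasure_eq_measure Q.emeasure_eq_measure
        by (rule order_trans) (intro add_right_mono ennreal_leI, simp)
      also have "\<dots> = ennreal (\<bar>d n\<bar> + (e * S + 1 / e * measure (Q n) (A n)))"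
        using e S by (simp add: ennreal_mult[symmetric] ennreal_plus[symmetric] del: ennreal_plus)
      finally have "measure (P n) (A n) \<le> \<bar>d n\<bar> + (e * S + 1 / e * measure (Q n) (A n))"
        using e S by (subst (asm) ennreal_le_iff) auto
      with elim(1) show ?case by simp
    qed
  qed
qed

lemma (in positive_density) prob_space_Wig:
  assumes "prob_space (X n)" "sets (X n) = sets (vec_space n)"
  shows "prob_space (Wig n l P X)"
proof -
  interpret X: prob_space "X n" by fact
  interpret noise: prob_space "noise n" by (rule prob_space_noise)
  interpret pair_prob_space "X n" "noise n" ..
  show ?thesis
    unfolding Wig_def wigner_noise_eq split_beta
    by (intro prob_space_distr spiked_matrix_measurable_X assms)
qed

theorem theorem4p4:
  fixes X :: "nat \<Rightarrow> (nat \<Rightarrow> real) measure"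
    and P :: "real measure"
    and p :: "real \<Rightarrow> real"
    and l :: real
  assumes spike: "spike_prior X"
    and prob: "prob_space P"
    and second_moment: "integrable P (\<lambda>w. w\<^sup>2)"
    and mean: "prob_space.expectation P (\<lambda>w. w) = 0"
    and variance: "prob_space.variance P (\<lambda>w. w) = 1"
    and entries: "(\<lambda>n. \<P>(x in X n. \<forall>i<n. \<bar>x i\<bar> < real n powr (- 1 / 3))) \<longlonglongrightarrow> 1"
    and norms: "\<And>q. q \<in> {2, 4, 6, 8} \<Longrightarrow>
      \<exists>\<alpha>::real. (\<lambda>n. \<P>(x in X n. lq_norm q n x > \<alpha> * real n powr (1 / real q - 1 / 2))) \<longlonglongrightarrow> 0"
    and density: "P = density lborel (\<lambda>w. ennreal (p w))"
    and differentiable: "\<And>w. p differentiable (at w)"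
    and positive: "\<And>w. p w > 0"
    and translation: "\<exists>U. open U \<and> (0, 0) \<in> U \<and> (\<forall>ab\<in>U. translation_finite P p ab) \<and>
      Ck_on 4 (translation_function P p) U"
    and symmetric: "distr P borel uminus = P"
    and nonneg: "0 \<le> l"
    and below: "ereal l < gaussian_threshold X / ereal (sqrt (fisher_information p))"
  shows "contiguous (\<lambda>n. Wig n l P X) (\<lambda>n. Wig n 0 P X)"
proof -
  interpret positive_density P p
    by (rule positive_density.intro[OF prob density differentiable positive])
  have prob_X: "prob_space (X n)" and sets_X: "sets (X n) = sets (vec_space n)" for n
    using spike by (auto simp: spike_prior_def)
  obtain U where U: "open U" "(0, 0) \<in> U" "\<And>ab. ab \<in> U \<Longrightarrow> translation_finite P p ab"
    "Ck_on 4 (translation_function P p) U"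
    using translation by blast
  obtain c C r where c: "0 \<le> c" "c \<le> fisher_information p" and C: "0 \<le> C" and r: "r > 0"
    and fin: "\<And>a b. \<bar>a\<bar> < r \<Longrightarrow> \<bar>b\<bar> < r \<Longrightarrow> translation_finite P p (a, b)"
    and bound: "\<And>a b. \<bar>a\<bar> < r \<Longrightarrow> \<bar>b\<bar> < r \<Longrightarrow> \<tau> a b \<le> c * (a * b) + C * (a ^ 4 + b ^ 4)"
    using translation_function_bound[OF U symmetric] by metis
  \<comment> \<open>The Gaussian second moment is used at \<open>l'\<close>, because
    \<open>c * l\<^sup>2\<close> is at most \<open>fisher_information p * l\<^sup>2\<close> and
    hence at most \<open>l'\<^sup>2\<close>.\<close>
  obtain l' C' where l': "fisher_information p * l\<^sup>2 \<le> l'\<^sup>2"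
    and C': "\<forall>\<^sub>F n in sequentially. gaussian_second_moment X l' n \<le> ennreal C'"
    using gaussian_threshold_witness[OF nonneg fisher_information_nonneg below prob_X] by metis
  \<comment> \<open>This makes the sum of the fourth powers of the entries \<open>O(1/n)\<close>, as
    the quartic remainder of \<open>\<tau>\<close> requires.\<close>
  obtain \<alpha> where \<alpha>: "(\<lambda>n. \<P>(x in X n. lq_norm 4 n x > \<alpha> * real n powr (1 / real 4 - 1 / 2))) \<longlonglongrightarrow> 0"
    using norms[of 4] by blast
  define small where "small n = {x \<in> space (X n). \<forall>i<n. \<bar>x i\<bar> < real n powr (- 1 / 3)}" for n
  define large where "large n = {x \<in> space (X n). lq_norm 4 n x > \<alpha> * real n powr (1 / real 4 - 1 / 2)}" for n
  \<comment> \<open>Spikes for which the quartic remainder is bounded and, once \<open>n\<close> is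
    large, every shift lies in the range of the expansion of \<open>\<tau>\<close>.\<close>
  define G where "G n = small n - large n" for n
  have coord: "(\<lambda>x. x i) \<in> borel_measurable (X n)" if "i < n" for i n
    using that by (simp add: measurable_cong_sets[OF sets_X refl] measurable_component_singleton)
  have small_sets: "small n \<in> sets (X n)" for n
  proof -
    have "small n = {x \<in> space (X n). \<forall>i\<in>{..<n}. \<bar>x i\<bar> < real n powr (- 1 / 3)}"
      by (auto simp: small_def)
    also have "\<dots> \<in> sets (X n)"
      by (intro sets.sets_Collect_finite_All borel_measurable_less borel_measurable_abs coord) auto
    finally show ?thesis .
  qed
  have large_sets: "large n \<in> sets (X n)" for n
  proof -
    have "(\<lambda>x. \<Sum>i<n. \<bar>x i\<bar> ^ 4) \<in> borel_measurable (X n)"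
      by (intro borel_measurable_sum borel_measurable_power borel_measurable_abs coord) auto
    moreover have "root 4 \<in> borel_measurable borel"
      by (intro borel_measurable_continuous_onI continuous_intros)
    ultimately have "lq_norm 4 n \<in> borel_measurable (X n)"
      unfolding lq_norm_def[abs_def] by (rule measurable_compose)
    then show ?thesis unfolding large_def by measurable
  qed
  have G_sets: "G n \<in> sets (X n)" for n
    using small_sets large_sets by (auto simp: G_def)
  \<comment> \<open>The union bound for the probability of the complement of
    \<open>G n\<close>.\<close>
  define d where "d n = 1 - measure (X n) (small n) + measure (X n) (large n)" for n
  have d: "d \<longlonglongrightarrow> 0"
    unfolding d_def[abs_def] using tendsto_add[OF tendsto_diff[OF tendsto_const[of 1] entries] \<alpha>]
    by (simp add: small_def large_def)
  have G_compl: "emeasure (X n) (space (X n) - G n) \<le> ennreal (d n)" for n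
  proof -
    interpret X: prob_space "X n" by (rule prob_X)
    have "measure (X n) (space (X n) - G n) \<le> measure (X n) ((space (X n) - small n) \<union> large n)"
      using small_sets large_sets by (intro X.finite_measure_mono) (auto simp: G_def)
    also have "\<dots> \<le> measure (X n) (space (X n) - small n) + measure (X n) (large n)"
      using small_sets large_sets by (intro measure_Un_le) auto
    finally show ?thesis
      unfolding X.emeasure_eq_measure d_def X.prob_compl[OF small_sets] by (rule ennreal_leI)
  qed
  \<comment> \<open>The contribution of the quartic remainder to the second moment, uniform in
    \<open>n\<close>.\<close>
  define K where "K = exp (C * l ^ 4 * (\<alpha> ^ 4)\<^sup>2)"
  \<comment> \<open>The entry bound gives shifts of order \<open>n powr (1 / 2 - 2 / 3)\<close>,
    that is \<open>n powr (- 1 / 6)\<close>, eventually below \<open>r\<close>.\<close>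
  have "(\<lambda>n. l * sqrt (real n) * (real n powr (- 1 / 3) * real n powr (- 1 / 3))) \<longlonglongrightarrow> 0"
    by real_asymp
  then have "\<forall>\<^sub>F n in sequentially. l * sqrt (real n) * (real n powr (- 1 / 3) * real n powr (- 1 / 3)) < r"
    using r by (intro order_tendstoD(2))
  then have second: "\<forall>\<^sub>F n in sequentially. n > 0 \<and> (\<integral>\<^sup>+x. \<integral>\<^sup>+x'. indicator (G n) x * indicator (G n) x' *
        (\<integral>\<^sup>+w. ennreal (likelihood n (spike_shift n l x) w) * ennreal (likelihood n (spike_shift n l x') w) \<partial>noise n)
        \<partial>X n \<partial>X n) \<le> ennreal (K * max C' 0)"
    using C' eventually_gt_at_top[of 0]
  proof eventually_elim
    case (elim n)
    interpret X: prob_space "X n" by (rule prob_X)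
    define g where "g x x' = ennreal (exp (l'\<^sup>2 * n / 2 * (\<Sum>i<n. x i * x' i)\<^sup>2))" for x x' :: "nat \<Rightarrow> real"
    have shift: "\<bar>spike_shift n l x k\<bar> < r" if x: "x \<in> G n" and k: "k \<in> upper_pairs n" for x k
    proof -
      obtain i j where k': "k = (i, j)" "i < n" "j < n" using k by (auto simp: upper_pairs_def)
      have "\<bar>spike_shift n l x k\<bar> = l * sqrt n * (\<bar>x i\<bar> * \<bar>x j\<bar>)"
        using nonneg by (simp add: spike_shift_def k'(1) abs_mult)
      also have "\<dots> \<le> l * sqrt n * (real n powr (- 1 / 3) * real n powr (- 1 / 3))"
        using x k' nonneg by (intro mult_left_mono mult_mono) (auto simp: G_def small_def less_imp_le)
      finally show ?thesis using elim(1) by simp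
    qed
    have pow4: "(\<Sum>i<n. x i ^ 4) \<le> \<alpha> ^ 4 / n" if "x \<in> G n" for x
      using that elim(3) by (intro sum_pow4_le_of_lq_norm) (auto simp: G_def small_def large_def)
    \<comment> \<open>If either spike lies outside \<open>G n\<close> the left side is zero, so the
      Gaussian bound may be integrated over all pairs of spikes.\<close>
    have pointwise: "indicator (G n) x * indicator (G n) x' *
        (\<integral>\<^sup>+w. ennreal (likelihood n (spike_shift n l x) w) * ennreal (likelihood n (spike_shift n l x') w) \<partial>noise n)
        \<le> ennreal K * g x x'" for x x'
    proof (cases "x \<in> G n \<and> x' \<in> G n")
      case True
      then have x: "x \<in> G n" and x': "x' \<in> G n" by auto
      have "(\<Sum>k\<in>upper_pairs n. \<tau> (spike_shift n l x k) (spike_shift n l x' k))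
          \<le> c * l\<^sup>2 * n / 2 * (\<Sum>i<n. x i * x' i)\<^sup>2 + C * l ^ 4 * (\<alpha> ^ 4)\<^sup>2"
        by (rule sum_translation_function_le[OF bound c(1) C elim(3) shift[OF x] shift[OF x'] pow4[OF x] pow4[OF x']])
      also have "\<dots> \<le> l'\<^sup>2 * n / 2 * (\<Sum>i<n. x i * x' i)\<^sup>2 + C * l ^ 4 * (\<alpha> ^ 4)\<^sup>2"
        using order_trans[OF mult_right_mono[OF c(2)] l']
        by (intro add_right_mono mult_right_mono divide_right_mono) auto
      finally have "exp (\<Sum>k\<in>upper_pairs n. \<tau> (spike_shift n l x k) (spike_shift n l x' k))
          \<le> K * exp (l'\<^sup>2 * n / 2 * (\<Sum>i<n. x i * x' i)\<^sup>2)"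
        by (simp add: K_def exp_add[symmetric] add.commute)
      moreover have "(\<integral>\<^sup>+w. ennreal (likelihood n (spike_shift n l x) w) * ennreal (likelihood n (spike_shift n l x') w) \<partial>noise n)
          = ennreal (exp (\<Sum>k\<in>upper_pairs n. \<tau> (spike_shift n l x k) (spike_shift n l x' k)))"
        by (intro likelihood_second_moment fin shift x x')
      ultimately show ?thesis
        using x x' by (simp add: g_def K_def ennreal_leI flip: ennreal_mult)
    qed auto
    have g: "(\<lambda>(x, x'). g x x') \<in> borel_measurable (X n \<Otimes>\<^sub>M X n)"
    proof -
      have "(\<lambda>z. \<Sum>i<n. fst z i * snd z i) \<in> borel_measurable (X n \<Otimes>\<^sub>M X n)"
        by (intro borel_measurable_sum borel_measurable_times measurable_compose[OF measurable_fst coord]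
            measurable_compose[OF measurable_snd coord]) auto
      then show ?thesis unfolding g_def split_beta by measurable
    qed
    have "(\<integral>\<^sup>+x. \<integral>\<^sup>+x'. indicator (G n) x * indicator (G n) x' *
        (\<integral>\<^sup>+w. ennreal (likelihood n (spike_shift n l x) w) * ennreal (likelihood n (spike_shift n l x') w) \<partial>noise n)
        \<partial>X n \<partial>X n) \<le> (\<integral>\<^sup>+x. \<integral>\<^sup>+x'. ennreal K * g x x' \<partial>X n \<partial>X n)"
      by (intro nn_integral_mono pointwise)
    also have "\<dots> = (\<integral>\<^sup>+z. ennreal K * (case z of (x, x') \<Rightarrow> g x x') \<partial>(X n \<Otimes>\<^sub>M X n))"
      using g by (subst X.nn_integral_fst[symmetric]) auto
    also have "\<dots> = ennreal K * gaussian_second_moment X l' n"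
      using g by (simp add: nn_integral_cmult gaussian_second_moment_def g_def)
    \<comment> \<open>Taking the maximum with \<open>0\<close> costs nothing, since
      \<open>ennreal\<close> sends negative reals to \<open>0\<close>, and it makes
      \<open>ennreal\<close> multiplicative here.\<close>
    also have "\<dots> \<le> ennreal K * ennreal (max C' 0)"
      using elim(2) by (intro mult_left_mono) (auto intro: order_trans simp: ennreal_leI)
    also have "\<dots> = ennreal (K * max C' 0)" by (simp add: K_def ennreal_mult)
    finally show ?case using elim(3) by blast
  qed
  show ?thesis
  proof (rule contiguousI_second_moment[OF _ _ d])
    show "prob_space (Wig n l P X)" "prob_space (Wig n 0 P X)" for n
      by (intro prob_space_Wig prob_X sets_X)+
    show "0 \<le> K * max C' 0" by (simp add: K_def)
    fix e :: real and A assume e: "e > 0" and A: "\<And>n. A n \<in> sets (Wig n 0 P X)"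
    from second show "\<forall>\<^sub>F n in sequentially. emeasure (Wig n l P X) (A n)
        \<le> ennreal (d n) + (ennreal e * ennreal (K * max C' 0) + ennreal (1 / e) * emeasure (Wig n 0 P X) (A n))"
    proof eventually_elim
      case (elim n)
      have "A n \<in> sets (mat_space n)" using A[of n] by (simp add: Wig_def)
      from emeasure_Wig_le[of X n, OF prob_X sets_X _ this G_sets e] elim
      have "emeasure (Wig n l P X) (A n) \<le> emeasure (X n) (space (X n) - G n)
          + (ennreal e * ennreal (K * max C' 0) + ennreal (1 / e) * emeasure (Wig n 0 P X) (A n))" by blast
      also have "\<dots> \<le> ennreal (d n)
          + (ennreal e * ennreal (K * max C' 0) + ennreal (1 / e) * emeasure (Wig n 0 P X) (A n))"
        by (intro add_right_mono G_compl)
      finally show ?case .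
    qed
  qed
qed

end
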